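(* Let $d\ge 2$, let $D_N\subset U^d$ be an arbitrary $N$-point set, and let $0<q\le 1$. Suppose that an integer $s$ satisfies $$s\ge \log N+\frac{2d+1}{q}+\frac12(d-1)\log(d-1)+d+1+\log d.$$ Then $$\mathcal M_{s,q}[D_N]>\gamma_q(d)(\log N)^{\frac12(d-1)},\qquad \gamma_q(d)=2^{-(2d+1)/q-d-1}(d-1)^{-\frac12(d-1)}.$$ In particular, there exist dyadic shifts $T\in\mathbb Q^d(2^s)$ such that $\mathcal L_q[D_N\oplus T]>\gamma_q(d)(\log N)^{\frac12(d-1)}$.
   Context: $\log$ denotes the logarithm in base 2. $U^d=[0,1)^d$. For a finite set $D\subset U^d$ and $Y=(y_1,\dots,y_d)\in U^d$, let $B_Y=[0,y_1)\times\dots\times[0,y_d)$ and $\mathcal L[D,Y]=|D\cap B_Y|-|D|\,y_1\cdots y_d$. For $0<q<\infty$, $\mathcal L_q[D]=\left(\int_{U^d}|\mathcal L[D,Y]|^q\,dY\right)^{1/q}$. Every $y\in[0,1)$ has a unique dyadic expansion $y=\sum_{a\ge1}\eta_a(y)2^{-a}$, $\eta_a(y)\in\{0,1\}$, with infinitely many zero digits. $\mathbb Q(2^s)=\{m2^{-s}:0\le m\le 2^s-1\}$, $\mathbb Q^d(2^s)=\mathbb Q(2^s)^d$. For $x\in[0,1)$ and $t\in\mathbb Q(2^s)$, $x\oplus t$ is defined by $\eta_a(x\oplus t)=\eta_a(x)+\eta_a(t)\bmod 2$; for $X\in U^d$, $T\in\mathbb Q^d(2^s)$ this is applied coordinatewise,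 and $D\oplus T=\{X\oplus T:X\in D\}$. The mean discrepancy is $\mathcal M_{s,q}[D]=\left(2^{-ds}\sum_{T\in\mathbb Q^d(2^s)}\mathcal L_q[D\oplus T]^q\right)^{1/q}$. *)

theory Defs
  imports "HOL-Analysis.Analysis"
begin

text \<open>Points of the cube are vectors of type \<open>real ^ 'n\<close>, so that the dimension is \<open>d = CARD('n)\<close>.\<close>

definition unit_cube :: "(real ^ 'n) set" where
  "unit_cube = {X. \<forall>i. 0 \<le> X $ i \<and> X $ i < 1}"

definition corner_box :: "real ^ 'n \<Rightarrow> (real ^ 'n) set" where
  "corner_box Y = {X. \<forall>i. 0 \<le> X $ i \<and> X $ i < Y $ i}"

definition local_discrepancy :: "(real ^ 'n) set \<Rightarrow> real ^ 'n \<Rightarrow> real" where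
  "local_discrepancy D Y =
     real (card (D \<inter> corner_box Y)) - real (card D) * (\<Prod>i\<in>UNIV. Y $ i)"

definition Lq_discrepancy :: "real \<Rightarrow> (real ^ 'n) set \<Rightarrow> real" where
  "Lq_discrepancy q D =
     (LINT Y:unit_cube|lborel. \<bar>local_discrepancy D Y\<bar> powr q) powr (1 / q)"


subsection \<open>Dyadic digits and dyadic shifts\<close>

text \<open>
  Digit sequences are indexed from 1. Index 0 is the integer part of a number in \<open>[0,1)\<close>, which is 0;
  requiring \<open>e 0 = 0\<close> makes the expansion unique as a function on \<open>nat\<close>.
\<close>

definition dyadic_expansion :: "(nat \<Rightarrow> nat) \<Rightarrow> real \<Rightarrow> bool" where
  "dyadic_expansion e y \<longleftrightarrow>
     e 0 = 0 \<and> (\<forall>a\<ge>1. e a \<in> {0, 1}) \<and> infinite {a. a \<ge> 1 \<and> e a = 0} \<and>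
     (\<lambda>a. real (e a) / 2 ^ a) sums y"

definition dyadic_digit :: "nat \<Rightarrow> real \<Rightarrow> nat" where
  "dyadic_digit a y = (THE e. dyadic_expansion e y) a"

definition dyadic_rationals :: "nat \<Rightarrow> real set" where
  "dyadic_rationals s = {real m / 2 ^ s | m. m \<le> 2 ^ s - 1}"

definition dyadic_vectors :: "nat \<Rightarrow> (real ^ 'n) set" where
  "dyadic_vectors s = {T. \<forall>i. T $ i \<in> dyadic_rationals s}"

definition dyadic_add :: "real \<Rightarrow> real \<Rightarrow> real" where
  "dyadic_add x t = (THE z. 0 \<le> z \<and> z < 1 \<and>
     (\<forall>a\<ge>1. dyadic_digit a z = (dyadic_digit a x + dyadic_digit a t) mod 2))"

definition dyadic_add_vec :: "real ^ 'n \<Rightarrow> real ^ 'n \<Rightarrow> real ^ 'n" where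
  "dyadic_add_vec X T = (\<chi> i. dyadic_add (X $ i) (T $ i))"

definition dyadic_shift :: "(real ^ 'n) set \<Rightarrow> real ^ 'n \<Rightarrow> (real ^ 'n) set" where
  "dyadic_shift D T = (\<lambda>X. dyadic_add_vec X T) ` D"

definition mean_discrepancy :: "nat \<Rightarrow> real \<Rightarrow> (real ^ 'n) set \<Rightarrow> real" where
  "mean_discrepancy s q D =
     (2 powr (- real (CARD('n) * s)) *
      (\<Sum>T\<in>dyadic_vectors s. Lq_discrepancy q (dyadic_shift D T) powr q)) powr (1 / q)"

definition gamma_const :: "real \<Rightarrow> nat \<Rightarrow> real" where
  "gamma_const q d =
     2 powr (- (2 * real d + 1) / q - real d - 1) *
     (real d - 1) powr (- (1 / 2) * (real d - 1))"


subsection \<open>The definite descriptions above are proper\<close>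

lemma dyadic_expansion_le_1:
  assumes "dyadic_expansion e y"
  shows "e a \<le> 1"
proof (cases "a = 0")
  case False
  then have "a \<ge> 1" by simp
  then have "e a \<in> {0, 1}"
    using assms unfolding dyadic_expansion_def by blast
  then show ?thesis by auto
qed (use assms in \<open>simp add: dyadic_expansion_def\<close>)

lemma dyadic_expansion_floor_bounds:
  assumes "dyadic_expansion e y"
  shows "(\<Sum>a\<le>n. real (e a) / 2 ^ a) \<le> y" "y < (\<Sum>a\<le>n. real (e a) / 2 ^ a) + 1 / 2 ^ n"
proof -
  define S where "S = (\<lambda>m. \<Sum>a\<le>m. real (e a) / 2 ^ a)"
  have lim: "S \<longlonglongrightarrow> y"
    using assms by (simp add: dyadic_expansion_def sums_def_le S_def)
  have le1: "e a \<le> 1" for a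
    by (rule dyadic_expansion_le_1[OF assms])
  have "incseq S"
    by (rule incseq_SucI) (simp add: S_def)
  then have "S n \<le> y"
    using lim by (rule incseq_le)
  then show "(\<Sum>a\<le>n. real (e a) / 2 ^ a) \<le> y" by (simp add: S_def)
  have "infinite {a. a \<ge> 1 \<and> e a = 0}"
    using assms by (simp add: dyadic_expansion_def)
  then obtain j where j: "j > n" "e j = 0"
    unfolding infinite_nat_iff_unbounded by blast
  have step: "S (Suc m) + 1 / 2 ^ Suc m \<le> S m + 1 / 2 ^ m" for m
    using le1[of "Suc m"] by (simp add: S_def field_simps)
  have dec: "S m + 1 / 2 ^ m \<le> S k + 1 / 2 ^ k" if "k \<le> m" for m k
    using that by (induction m rule: dec_induct) (use step order.trans in blast)+
  obtain i where i: "j = Suc i" "n \<le> i" using j by (cases j) auto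
  have "S m \<le> S j + 1 / 2 ^ j" if "j \<le> m" for m
    using dec[OF that] by (smt (verit) divide_nonneg_nonneg zero_le_power)
  then have "y \<le> S j + 1 / 2 ^ j"
    by (intro Lim_bounded[OF lim, of j]) auto
  also have "S j + 1 / 2 ^ j < S i + 1 / 2 ^ i"
    using j i by (simp add: S_def field_simps)
  also have "\<dots> \<le> S n + 1 / 2 ^ n"
    using dec i by blast
  finally show "y < (\<Sum>a\<le>n. real (e a) / 2 ^ a) + 1 / 2 ^ n" by (simp add: S_def)
qed

lemma dyadic_expansion_floor:
  assumes "dyadic_expansion e y"
  shows "int (e n) = \<lfloor>y * 2 ^ n\<rfloor> mod 2"
proof -
  define I where "I = (\<lambda>n. \<Sum>a\<le>n. int (e a) * 2 ^ (n - a))"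
  have I: "real_of_int (I n) = (\<Sum>a\<le>n. real (e a) / 2 ^ a) * 2 ^ n" for n
    unfolding I_def of_int_sum sum_distrib_right
  proof (intro sum.cong refl)
    fix a assume "a \<in> {..n}"
    then have "(2::real) ^ (n - a) = 2 ^ n / 2 ^ a" by (simp add: power_diff)
    then show "real_of_int (int (e a) * 2 ^ (n - a)) = real (e a) / 2 ^ a * 2 ^ n" by simp
  qed
  have fl: "\<lfloor>y * 2 ^ n\<rfloor> = I n" for n
  proof (rule floor_unique)
    show "real_of_int (I n) \<le> y * 2 ^ n"
      unfolding I using dyadic_expansion_floor_bounds(1)[OF assms, of n] by simp
    show "y * 2 ^ n < real_of_int (I n) + 1"
      unfolding I using dyadic_expansion_floor_bounds(2)[OF assms, of n] by (simp add: field_simps)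
  qed
  have lt: "e n < 2"
    using dyadic_expansion_le_1[OF assms, of n] by simp
  show ?thesis
  proof (cases n)
    case 0
    then show ?thesis using lt fl[of n] by (simp add: I_def)
  next
    case (Suc k)
    have "(\<Sum>a\<le>k. int (e a) * 2 ^ (Suc k - a)) = 2 * I k"
      unfolding I_def sum_distrib_left by (intro sum.cong) (auto simp: Suc_diff_le)
    then have "I n = 2 * I k + int (e n)"
      by (simp add: Suc I_def)
    then show ?thesis using lt by (simp add: fl)
  qed
qed

lemma dyadic_expansion_exists:
  assumes "0 \<le> y" "y < 1"
  shows "dyadic_expansion (\<lambda>a. nat (\<lfloor>y * 2 ^ a\<rfloor> mod 2)) y"
proof -
  define e where "e = (\<lambda>a. nat (\<lfloor>y * 2 ^ a\<rfloor> mod 2))"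
  have e0: "e 0 = 0"
    using assms by (simp add: e_def floor_eq_iff)
  have re: "real (e a) = real_of_int (\<lfloor>y * 2 ^ a\<rfloor> mod 2)" for a
    by (simp add: e_def)
  have fl2: "\<lfloor>y * 2 ^ Suc n\<rfloor> = 2 * \<lfloor>y * 2 ^ n\<rfloor> + \<lfloor>y * 2 ^ Suc n\<rfloor> mod 2" for n
  proof -
    have "\<lfloor>y * 2 ^ n\<rfloor> = \<lfloor>y * 2 ^ Suc n\<rfloor> div 2"
      using floor_divide_real_eq_div[of 2 "y * 2 ^ Suc n"] by simp
    then show ?thesis by presburger
  qed
  have S: "(\<Sum>a\<le>n. real (e a) / 2 ^ a) = \<lfloor>y * 2 ^ n\<rfloor> / 2 ^ n" for n
  proof (induction n)
    case 0
    show ?case using e0 assms by (simp add: floor_eq_iff)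
  next
    case (Suc n)
    have "real_of_int \<lfloor>y * 2 ^ Suc n\<rfloor> = 2 * real_of_int \<lfloor>y * 2 ^ n\<rfloor> + real (e (Suc n))"
      unfolding re by (subst fl2) simp
    then show ?case by (simp add: Suc field_simps)
  qed
  have "(\<lambda>n. \<Sum>a\<le>n. real (e a) / 2 ^ a) \<longlonglongrightarrow> y"
  proof (rule tendsto_sandwich)
    show "\<forall>\<^sub>F n in sequentially. y - (1/2) ^ n \<le> (\<Sum>a\<le>n. real (e a) / 2 ^ a)"
    proof (intro always_eventually allI)
      fix n
      have "y * 2 ^ n - 1 \<le> \<lfloor>y * 2 ^ n\<rfloor>" by linarith
      then have "(y * 2 ^ n - 1) / 2 ^ n \<le> \<lfloor>y * 2 ^ n\<rfloor> / 2 ^ n"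
        by (rule divide_right_mono) simp
      then show "y - (1/2) ^ n \<le> (\<Sum>a\<le>n. real (e a) / 2 ^ a)"
        unfolding S by (simp add: diff_divide_distrib power_one_over)
    qed
    show "\<forall>\<^sub>F n in sequentially. (\<Sum>a\<le>n. real (e a) / 2 ^ a) \<le> y"
      unfolding S by (intro always_eventually allI) (simp add: field_simps)
    show "(\<lambda>n. y - (1/2) ^ n) \<longlonglongrightarrow> y"
      using tendsto_diff[OF tendsto_const LIMSEQ_realpow_zero, of "1/2" y] by simp
  qed simp
  then have sums: "(\<lambda>a. real (e a) / 2 ^ a) sums y"
    by (simp add: sums_def_le)
  have "infinite {a. a \<ge> 1 \<and> e a = 0}"
  proof
    assume "finite {a. a \<ge> 1 \<and> e a = 0}"
    then obtain m where le_m: "\<forall>a\<in>{a. a \<ge> 1 \<and> e a = 0}. a \<le> m"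
      unfolding finite_nat_set_iff_bounded_le by blast
    have m: "e a \<noteq> 0" if "a > m" for a
    proof
      assume "e a = 0"
      then have "a \<in> {a. a \<ge> 1 \<and> e a = 0}" using that by simp
      with le_m have "a \<le> m" by (rule bspec)
      then show False using that by simp
    qed
    have e1: "e a = 1" if "a > m" for a
      using m[OF that] by (simp add: e_def)
    have frac: "1 - (y * 2 ^ n - \<lfloor>y * 2 ^ n\<rfloor>) = 2 ^ (n - m) * (1 - (y * 2 ^ m - \<lfloor>y * 2 ^ m\<rfloor>))"
      if "n \<ge> m" for n
      using that
    proof (induction n rule: dec_induct)
      case (step n)
      have "real_of_int \<lfloor>y * 2 ^ Suc n\<rfloor> = 2 * real_of_int \<lfloor>y * 2 ^ n\<rfloor> + real (e (Suc n))"
        unfolding re by (subst fl2) simp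
      then have "1 - (y * 2 ^ Suc n - \<lfloor>y * 2 ^ Suc n\<rfloor>) = 2 * (1 - (y * 2 ^ n - \<lfloor>y * 2 ^ n\<rfloor>))"
        using e1[of "Suc n"] step by simp
      then show ?case using step by (simp add: Suc_diff_le)
    qed simp
    define c where "c = 1 - (y * 2 ^ m - \<lfloor>y * 2 ^ m\<rfloor>)"
    have c: "c > 0" unfolding c_def by linarith
    obtain k where "1 / c < 2 ^ k" using real_arch_pow[of 2 "1 / c"] by auto
    then have "1 < 2 ^ k * c" using c by (simp add: field_simps)
    moreover have "2 ^ k * c \<le> 1"
      using frac[of "m + k"] unfolding c_def[symmetric] by simp linarith
    ultimately show False by simp
  qed
  with e0 sums show ?thesis
    unfolding dyadic_expansion_def e_def[symmetric] by (auto simp: e_def)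
qed

lemma dyadic_expansion_ex1:
  assumes "0 \<le> y" "y < 1"
  shows "\<exists>!e. dyadic_expansion e y"
proof (rule ex_ex1I)
  show "\<exists>e. dyadic_expansion e y" using dyadic_expansion_exists[OF assms] by blast
  show "e = e'" if "dyadic_expansion e y" "dyadic_expansion e' y" for e e'
    using dyadic_expansion_floor[OF that(1)] dyadic_expansion_floor[OF that(2)]
    by (metis ext of_nat_eq_iff)
qed

lemma dyadic_digit_eqI:
  assumes "0 \<le> y" "y < 1" "dyadic_expansion e y"
  shows "dyadic_digit a y = e a"
  using the1_equality[where P = "\<lambda>e. dyadic_expansion e y", OF dyadic_expansion_ex1[OF assms(1,2)] assms(3)]
  by (simp add: dyadic_digit_def)

lemma dyadic_expansion_digit:
  assumes "0 \<le> y" "y < 1"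
  shows "dyadic_expansion (\<lambda>a. dyadic_digit a y) y"
  using theI'[where P = "\<lambda>e. dyadic_expansion e y", OF dyadic_expansion_ex1[OF assms]] by (simp add: dyadic_digit_def)

lemma dyadic_digit_floor:
  assumes "0 \<le> y" "y < 1"
  shows "dyadic_digit a y = nat (\<lfloor>y * 2 ^ a\<rfloor> mod 2)"
  using dyadic_digit_eqI[OF assms dyadic_expansion_exists[OF assms]] .

lemma dyadic_rationals_bounds:
  assumes "t \<in> dyadic_rationals s"
  shows "0 \<le> t" "t < 1"
proof -
  obtain m :: nat where m: "t = real m / 2 ^ s" "m \<le> 2 ^ s - 1"
    using assms by (auto simp: dyadic_rationals_def)
  then have "m < 2 ^ s" by (simp add: Suc_le_eq[symmetric] le_diff_conv2)
  then have "real m < 2 ^ s" by (metis of_nat_less_iff of_nat_numeral of_nat_power)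
  then show "0 \<le> t" "t < 1" using m by simp_all
qed

lemma dyadic_digit_rational:
  assumes "t \<in> dyadic_rationals s" "a > s"
  shows "dyadic_digit a t = 0"
proof -
  obtain m :: nat where m: "t = real m / 2 ^ s"
    using assms by (auto simp: dyadic_rationals_def)
  have "t * 2 ^ a = real_of_int (2 * (int m * 2 ^ (a - s - 1)))"
  proof -
    have "a = s + Suc (a - s - 1)" using assms(2) by simp
    then have "(2::real) ^ a = 2 ^ s * 2 * 2 ^ (a - s - 1)"
      by (metis mult.assoc power_Suc power_add)
    then show ?thesis by (simp add: m)
  qed
  then have "\<lfloor>t * 2 ^ a\<rfloor> = 2 * (int m * 2 ^ (a - s - 1))"
    by (metis floor_of_int)
  then show ?thesis
    using dyadic_digit_floor[OF dyadic_rationals_bounds[OF assms(1)]] by simp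
qed

lemma dyadic_add_ex1:
  assumes "0 \<le> x" "x < 1" "t \<in> dyadic_rationals s"
  shows "\<exists>!z. 0 \<le> z \<and> z < 1 \<and>
     (\<forall>a\<ge>1. dyadic_digit a z = (dyadic_digit a x + dyadic_digit a t) mod 2)"
proof (rule ex_ex1I)
  define e where "e = (\<lambda>a. (dyadic_digit a x + dyadic_digit a t) mod 2)"
  have X: "dyadic_expansion (\<lambda>a. dyadic_digit a x) x"
    by (rule dyadic_expansion_digit[OF assms(1,2)])
  have T: "dyadic_expansion (\<lambda>a. dyadic_digit a t) t"
    by (rule dyadic_expansion_digit[OF dyadic_rationals_bounds[OF assms(3)]])
  have e0: "e 0 = 0"
    using X T by (simp add: dyadic_expansion_def e_def)
  have e01: "e a \<in> {0, 1}" for a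
    by (auto simp: e_def)
  have "infinite ({a. a \<ge> 1 \<and> dyadic_digit a x = 0} - {..s})"
    using X by (simp add: dyadic_expansion_def)
  then have inf: "infinite {a. a \<ge> 1 \<and> e a = 0}"
    by (rule infinite_super[rotated]) (auto simp: e_def dyadic_digit_rational[OF assms(3)])
  have "summable (\<lambda>a. real (e a) / 2 ^ a)"
  proof (rule summable_comparison_test')
    show "summable (\<lambda>a. (1/2::real) ^ a)" by (rule summable_geometric) simp
    show "norm (real (e a) / 2 ^ a) \<le> (1/2) ^ a" for a
      using e01[of a] by (auto simp: field_simps)
  qed
  then have E: "dyadic_expansion e (\<Sum>a. real (e a) / 2 ^ a)"
    using e0 e01 inf by (simp add: dyadic_expansion_def summable_sums)
  have "0 \<le> (\<Sum>a. real (e a) / 2 ^ a)" "(\<Sum>a. real (e a) / 2 ^ a) < 1"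
    using dyadic_expansion_floor_bounds[OF E, of 0] e0 by simp_all
  then show "\<exists>z. 0 \<le> z \<and> z < 1 \<and>
     (\<forall>a\<ge>1. dyadic_digit a z = (dyadic_digit a x + dyadic_digit a t) mod 2)"
    using dyadic_digit_eqI[OF _ _ E] unfolding e_def[symmetric] by (metis (no_types, lifting) e_def)
next
  fix z w
  assume z: "0 \<le> z \<and> z < 1 \<and>
     (\<forall>a\<ge>1. dyadic_digit a z = (dyadic_digit a x + dyadic_digit a t) mod 2)"
  assume w: "0 \<le> w \<and> w < 1 \<and>
     (\<forall>a\<ge>1. dyadic_digit a w = (dyadic_digit a x + dyadic_digit a t) mod 2)"
  have Z: "dyadic_expansion (\<lambda>a. dyadic_digit a z) z" and W: "dyadic_expansion (\<lambda>a. dyadic_digit a w) w"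
    using z w dyadic_expansion_digit by auto
  have "dyadic_digit a z = dyadic_digit a w" for a
    using z w Z W by (cases "a = 0") (auto simp: dyadic_expansion_def)
  then show "z = w"
    using Z W unfolding dyadic_expansion_def by (metis (no_types, lifting) ext sums_unique2)
qed

end

theory Submission
  imports Defs
begin

unbundle bit_operations_syntax

text \<open>
  Fix \<open>W = T \<oplus> V\<close>, where \<open>V\<close> consists of the first \<open>s\<close> digits of \<open>Y\<close>, and fix the remaining digits of \<open>Y\<close>.
  In each coordinate, \<open>x \<oplus> t < y\<close> is decided by the first digit in which \<open>x \<oplus> t\<close> and \<open>y\<close> differ, that is,
  in which \<open>x\<close> and \<open>w\<close> differ: the inequality holds iff this digit of \<open>v\<close> is \<open>1\<close>. So the indicator is an
  affine function of the Rademacher functions of \<open>v\<close>, and the local discrepancy is a decoupled Rademacher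
  chaos in \<open>V\<close>. Its coefficient at \<open>(a\<^sub>1, \<dots>, a\<^sub>d)\<close> with all \<open>a\<^sub>i \<ge> 1\<close> is, up to sign, \<open>1 / 2 ^ d\<close> times
  an integer minus \<open>N / 2 ^ n\<close>, \<open>n = a\<^sub>1 + \<dots> + a\<^sub>d\<close>. If \<open>2 ^ n\<close> is slightly larger than \<open>N\<close>,
  all of these coefficients are bounded away from \<open>0\<close>, and there are about \<open>(log N) ^ (d - 1)\<close> of them.
  The fourth moment of the chaos is at most \<open>3 ^ d\<close> times the squared second moment, which bounds its
  \<open>q\<close>-th moment from below in terms of the second. Averaging over \<open>W\<close> and over the remaining digits
  of \<open>Y\<close> gives the bound.
\<close>

subsection \<open>Moments of decoupled Rademacher chaos\<close>

text \<open>The exponent has the parity of the \<open>a\<close>-th binary digit of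
  \<open>m / 2 ^ s\<close>, counted from the most significant one. Index \<open>a = 0\<close> reads
  a digit that vanishes for \<open>m < 2 ^ s\<close> and so supplies the constant function
  \<open>1\<close>.\<close>

definition rademacher :: "nat \<Rightarrow> nat \<Rightarrow> nat \<Rightarrow> real" where
  "rademacher s a m = (-1) ^ (m div 2 ^ (s - a))"

text \<open>Appending a new lowest digit \<open>c\<close> leaves the higher digits in place. This is
  the recursion behind all inductions on \<open>s\<close> below.\<close>

lemma rademacher_Suc:
  assumes "a \<le> s" "c < 2"
  shows "rademacher (Suc s) a (2 * m + c) = rademacher s a m"
proof -
  have "(2 * m + c) div 2 ^ (Suc s - a) = (2 * m + c) div 2 div 2 ^ (s - a)"
    using assms by (simp add: Suc_diff_le div_mult2_eq)
  also have "(2 * m + c) div 2 = m" using assms by simp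
  finally show ?thesis by (simp add: rademacher_def)
qed

lemma rademacher_0: "m < 2 ^ s \<Longrightarrow> rademacher s 0 m = 1"
  by (simp add: rademacher_def)

lemma rademacher_top: "rademacher s s m = (-1) ^ m"
  by (simp add: rademacher_def)

lemma sum_lessThan_double:
  fixes f :: "nat \<Rightarrow> 'a::comm_monoid_add"
  shows "(\<Sum>m<2 * n. f m) = (\<Sum>m<n. f (2 * m) + f (2 * m + 1))"
  by (induction n) (simp_all add: ac_simps)

text \<open>Orthogonality of the Rademacher functions. The induction averages over the two values of
  the last digit, which cancels the cross term.\<close>

lemma rademacher_second_moment:
  "(\<Sum>m<2 ^ s. (\<Sum>a\<le>s. h a * rademacher s a m)\<^sup>2) = 2 ^ s * (\<Sum>a\<le>s. (h a)\<^sup>2)"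
proof (induction s)
  case (Suc s)
  define S where "S = (\<lambda>m. \<Sum>a\<le>s. h a * rademacher s a m)"
  have *: "(\<Sum>a\<le>Suc s. h a * rademacher (Suc s) a (2 * m + c)) = S m + h (Suc s) * (-1) ^ c"
    if "c < 2" for m c
    using that by (simp add: S_def rademacher_Suc rademacher_top power_add power_mult)
  have "(\<Sum>m<2 ^ Suc s. (\<Sum>a\<le>Suc s. h a * rademacher (Suc s) a m)\<^sup>2)
      = (\<Sum>m<2 ^ s. (S m + h (Suc s))\<^sup>2 + (S m - h (Suc s))\<^sup>2)"
    unfolding power_Suc sum_lessThan_double using *[of 0] *[of 1] by simp
  also have "\<dots> = (\<Sum>m<2 ^ s. 2 * (S m)\<^sup>2 + 2 * (h (Suc s))\<^sup>2)"
    by (intro sum.cong refl) (simp add: power2_eq_square algebra_simps)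
  also have "\<dots> = 2 ^ Suc s * (\<Sum>a\<le>Suc s. (h a)\<^sup>2)"
    using Suc by (simp add: S_def sum.distrib sum_distrib_left[symmetric] algebra_simps)
  finally show ?case .
qed (simp add: rademacher_def)

text \<open>Khinchine's inequality for exponent 4. Averaging over the last digit removes the odd
  powers of \<open>b\<close>; the mixed term \<open>12 * b\<^sup>2 * (S m)\<^sup>2\<close> is
  evaluated by the second moment and fixes the constant 3.\<close>

lemma rademacher_fourth_moment:
  "(\<Sum>m<2 ^ s. (\<Sum>a\<le>s. h a * rademacher s a m) ^ 4) \<le> 2 ^ s * 3 * (\<Sum>a\<le>s. (h a)\<^sup>2)\<^sup>2"
proof (induction s)
  case 0
  have "h 0 ^ 4 \<le> 3 * ((h 0)\<^sup>2)\<^sup>2" by simp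
  then show ?case by (simp add: rademacher_def)
next
  case (Suc s)
  define S where "S = (\<lambda>m. \<Sum>a\<le>s. h a * rademacher s a m)"
  define A where "A = (\<Sum>a\<le>s. (h a)\<^sup>2)"
  define b where "b = h (Suc s)"
  have *: "(\<Sum>a\<le>Suc s. h a * rademacher (Suc s) a (2 * m + c)) = S m + b * (-1) ^ c"
    if "c < 2" for m c
    using that by (simp add: S_def b_def rademacher_Suc rademacher_top power_add power_mult)
  have "(\<Sum>m<2 ^ Suc s. (\<Sum>a\<le>Suc s. h a * rademacher (Suc s) a m) ^ 4)
      = (\<Sum>m<2 ^ s. (S m + b) ^ 4 + (S m - b) ^ 4)"
    unfolding power_Suc sum_lessThan_double using *[of 0] *[of 1] by simp
  also have "\<dots> = (\<Sum>m<2 ^ s. 2 * (S m) ^ 4 + 12 * b\<^sup>2 * (S m)\<^sup>2 + 2 * b ^ 4)"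
    by (intro sum.cong refl) (simp add: power2_eq_square power4_eq_xxxx algebra_simps)
  also have "\<dots> = 2 * (\<Sum>m<2 ^ s. (S m) ^ 4) + 12 * b\<^sup>2 * (\<Sum>m<2 ^ s. (S m)\<^sup>2) + 2 ^ s * (2 * b ^ 4)"
    by (simp add: sum.distrib sum_distrib_left)
  \<comment> \<open>Enlarging \<open>2 * b ^ 4\<close> to \<open>6 * b ^ 4\<close> completes the
    square.\<close>
  also have "\<dots> \<le> 2 * (2 ^ s * 3 * A\<^sup>2) + 12 * b\<^sup>2 * (2 ^ s * A) + 2 ^ s * (6 * b ^ 4)"
    using Suc rademacher_second_moment[of h s] by (intro add_mono) (auto simp: S_def A_def)
  also have "\<dots> = 2 ^ Suc s * 3 * (A + b\<^sup>2)\<^sup>2"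
    by (simp add: power2_eq_square power4_eq_xxxx algebra_simps)
  finally show ?case by (simp add: A_def b_def)
qed

section \<open>Products of blocks in several independent variables\<close>

lemma sum_PiE_insert:
  fixes f :: "('i \<Rightarrow> 'b) \<Rightarrow> 'c::comm_monoid_add"
  assumes "i \<notin> I"
  shows "(\<Sum>g\<in>PiE (insert i I) B. f g) = (\<Sum>g\<in>PiE I B. \<Sum>y\<in>B i. f (g(i := y)))"
proof -
  have "(\<Sum>g\<in>PiE (insert i I) B. f g) = (\<Sum>(y, g)\<in>B i \<times> PiE I B. f (g(i := y)))"
    unfolding PiE_insert_eq by (subst sum.reindex[OF inj_combinator[OF assms]]) (simp add: case_prod_unfold)
  also have "\<dots> = (\<Sum>y\<in>B i. \<Sum>g\<in>PiE I B. f (g(i := y)))"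
    by (simp add: sum.cartesian_product)
  also have "\<dots> = (\<Sum>g\<in>PiE I B. \<Sum>y\<in>B i. f (g(i := y)))"
    by (rule sum.swap)
  finally show ?thesis .
qed

text \<open>The triangle inequality in L2 for the squares of the functions \<open>H a\<close>:
  expand the outer square and bound each mixed term by Cauchy--Schwarz.\<close>

lemma sum_square_sum_squares_le:
  fixes H :: "'a \<Rightarrow> 'w \<Rightarrow> real"
  assumes "\<And>a. a \<in> J \<Longrightarrow> (\<Sum>w\<in>\<Omega>. H a w ^ 4) \<le> K * (\<sigma> a)\<^sup>2" "\<And>a. a \<in> J \<Longrightarrow> 0 \<le> \<sigma> a" "0 \<le> K"
  shows "(\<Sum>w\<in>\<Omega>. (\<Sum>a\<in>J. (H a w)\<^sup>2)\<^sup>2) \<le> K * (\<Sum>a\<in>J. \<sigma> a)\<^sup>2"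
proof -
  have "(\<Sum>w\<in>\<Omega>. (H a w)\<^sup>2 * (H b w)\<^sup>2) \<le> K * (\<sigma> a * \<sigma> b)" if "a \<in> J" "b \<in> J" for a b
  proof (rule power2_le_imp_le)
    have "(\<Sum>w\<in>\<Omega>. (H a w)\<^sup>2 * (H b w)\<^sup>2)\<^sup>2 \<le> (\<Sum>w\<in>\<Omega>. ((H a w)\<^sup>2)\<^sup>2) * (\<Sum>w\<in>\<Omega>. ((H b w)\<^sup>2)\<^sup>2)"
      by (rule Cauchy_Schwarz_ineq_sum)
    also have "\<dots> = (\<Sum>w\<in>\<Omega>. H a w ^ 4) * (\<Sum>w\<in>\<Omega>. H b w ^ 4)" by simp
    also have "\<dots> \<le> (K * (\<sigma> a)\<^sup>2) * (K * (\<sigma> b)\<^sup>2)"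
      using assms that by (intro mult_mono) (auto intro!: sum_nonneg)
    also have "\<dots> = (K * (\<sigma> a * \<sigma> b))\<^sup>2" by (simp add: power2_eq_square ac_simps)
    finally show "(\<Sum>w\<in>\<Omega>. (H a w)\<^sup>2 * (H b w)\<^sup>2)\<^sup>2 \<le> (K * (\<sigma> a * \<sigma> b))\<^sup>2" .
  qed (use assms that in auto)
  then have "(\<Sum>a\<in>J. \<Sum>b\<in>J. \<Sum>w\<in>\<Omega>. (H a w)\<^sup>2 * (H b w)\<^sup>2) \<le> (\<Sum>a\<in>J. \<Sum>b\<in>J. K * (\<sigma> a * \<sigma> b))"
    by (intro sum_mono) auto
  also have "\<dots> = K * (\<Sum>a\<in>J. \<sigma> a)\<^sup>2"
    unfolding power2_eq_square sum_product by (simp only: sum_distrib_left)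
  also have "(\<Sum>a\<in>J. \<Sum>b\<in>J. \<Sum>w\<in>\<Omega>. (H a w)\<^sup>2 * (H b w)\<^sup>2) = (\<Sum>w\<in>\<Omega>. (\<Sum>a\<in>J. (H a w)\<^sup>2)\<^sup>2)"
    unfolding power2_eq_square[of "sum _ _"] sum_product
    by (subst sum.swap[of _ \<Omega>]) (simp add: sum.swap[of _ \<Omega> J])
  finally show ?thesis .
qed

text \<open>
  In the fourth moment, the new block costs the factor \<open>C\<close> pointwise in the old variables, and the
  old blocks are handled by Cauchy--Schwarz; expanding one variable at a time, as in Bonami's lemma,
  would only give \<open>9\<close> instead of \<open>3\<close> per block.
\<close>

lemma tensor_moments:
  fixes \<phi> :: "'j \<Rightarrow> 'w \<Rightarrow> real"
  assumes second: "\<And>h. (\<Sum>w\<in>\<Omega>. (\<Sum>a\<in>J. h a * \<phi> a w)\<^sup>2) = M * (\<Sum>a\<in>J. (h a)\<^sup>2)"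
    and fourth: "\<And>h. (\<Sum>w\<in>\<Omega>. (\<Sum>a\<in>J. h a * \<phi> a w) ^ 4) \<le> M * C * (\<Sum>a\<in>J. (h a)\<^sup>2)\<^sup>2"
    and "0 \<le> M" "1 \<le> C" "finite I"
  shows "(\<Sum>w\<in>PiE I (\<lambda>_. \<Omega>). (\<Sum>g\<in>PiE I (\<lambda>_. J). c g * (\<Prod>i\<in>I. \<phi> (g i) (w i)))\<^sup>2)
           = M ^ card I * (\<Sum>g\<in>PiE I (\<lambda>_. J). (c g)\<^sup>2)"
    and "(\<Sum>w\<in>PiE I (\<lambda>_. \<Omega>). (\<Sum>g\<in>PiE I (\<lambda>_. J). c g * (\<Prod>i\<in>I. \<phi> (g i) (w i))) ^ 4)
           \<le> (M * C) ^ card I * (\<Sum>g\<in>PiE I (\<lambda>_. J). (c g)\<^sup>2)\<^sup>2"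
proof -
  have "(\<Sum>w\<in>PiE I (\<lambda>_. \<Omega>). (\<Sum>g\<in>PiE I (\<lambda>_. J). c g * (\<Prod>i\<in>I. \<phi> (g i) (w i)))\<^sup>2)
           = M ^ card I * (\<Sum>g\<in>PiE I (\<lambda>_. J). (c g)\<^sup>2)
    \<and> (\<Sum>w\<in>PiE I (\<lambda>_. \<Omega>). (\<Sum>g\<in>PiE I (\<lambda>_. J). c g * (\<Prod>i\<in>I. \<phi> (g i) (w i))) ^ 4)
           \<le> (M * C) ^ card I * (\<Sum>g\<in>PiE I (\<lambda>_. J). (c g)\<^sup>2)\<^sup>2"
    using \<open>finite I\<close>
  proof (induction I arbitrary: c rule: finite_induct)
    case empty
    have "(c (\<lambda>_. undefined)) ^ 4 = ((c (\<lambda>_. undefined))\<^sup>2)\<^sup>2" by simp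
    then show ?case by simp
  next
    case (insert i I)
    \<comment> \<open>Separate the new coordinate \<open>i\<close>: the chaos becomes a linear
      combination of the functions \<open>\<phi> a\<close> in the new variable. Its coefficients
      \<open>H a\<close> are chaoses in the old variables, to which the induction hypothesis
      applies, and \<sigma> collects their squared norms.\<close>
    define H where "H = (\<lambda>a w. \<Sum>g\<in>PiE I (\<lambda>_. J). c (g(i := a)) * (\<Prod>i\<in>I. \<phi> (g i) (w i)))"
    define \<sigma> where "\<sigma> = (\<lambda>a. \<Sum>g\<in>PiE I (\<lambda>_. J). (c (g(i := a)))\<^sup>2)"
    have prod_upd: "(\<Prod>j\<in>I. \<phi> ((g(i := a)) j) ((w(i := y)) j)) = (\<Prod>j\<in>I. \<phi> (g j) (w j))" for g a w y
      using insert.hyps by (intro prod.cong) auto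
    have F: "(\<Sum>g\<in>PiE (insert i I) (\<lambda>_. J). c g * (\<Prod>j\<in>insert i I. \<phi> (g j) ((w(i := y)) j)))
        = (\<Sum>a\<in>J. H a w * \<phi> a y)" for w y
      unfolding sum_PiE_insert[OF insert.hyps(2)] prod.insert[OF insert.hyps] prod_upd H_def
      by (subst sum.swap) (simp add: sum_distrib_left sum_distrib_right ac_simps)
    have \<sigma>: "(\<Sum>g\<in>PiE (insert i I) (\<lambda>_. J). (c g)\<^sup>2) = (\<Sum>a\<in>J. \<sigma> a)"
      unfolding sum_PiE_insert[OF insert.hyps(2)] \<sigma>_def by (rule sum.swap)
    have IH2: "(\<Sum>w\<in>PiE I (\<lambda>_. \<Omega>). (H a w)\<^sup>2) = M ^ card I * \<sigma> a"
      and IH4: "(\<Sum>w\<in>PiE I (\<lambda>_. \<Omega>). (H a w) ^ 4) \<le> (M * C) ^ card I * (\<sigma> a)\<^sup>2" for a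
      using insert.IH[of "\<lambda>g. c (g(i := a))"] by (auto simp: H_def \<sigma>_def)
    have "(\<Sum>w\<in>PiE I (\<lambda>_. \<Omega>). \<Sum>y\<in>\<Omega>. (\<Sum>a\<in>J. H a w * \<phi> a y)\<^sup>2)
        = M * (\<Sum>a\<in>J. \<Sum>w\<in>PiE I (\<lambda>_. \<Omega>). (H a w)\<^sup>2)"
      unfolding second by (subst sum.swap) (simp add: sum_distrib_left)
    also have "\<dots> = M ^ card (insert i I) * (\<Sum>a\<in>J. \<sigma> a)"
      unfolding IH2 sum_distrib_left[symmetric] using insert.hyps by simp
    finally have two: "(\<Sum>w\<in>PiE I (\<lambda>_. \<Omega>). \<Sum>y\<in>\<Omega>. (\<Sum>a\<in>J. H a w * \<phi> a y)\<^sup>2)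
        = M ^ card (insert i I) * (\<Sum>a\<in>J. \<sigma> a)" .
    have "(\<Sum>w\<in>PiE I (\<lambda>_. \<Omega>). \<Sum>y\<in>\<Omega>. (\<Sum>a\<in>J. H a w * \<phi> a y) ^ 4)
        \<le> (\<Sum>w\<in>PiE I (\<lambda>_. \<Omega>). M * C * (\<Sum>a\<in>J. (H a w)\<^sup>2)\<^sup>2)"
      by (intro sum_mono fourth)
    also have "\<dots> = M * C * (\<Sum>w\<in>PiE I (\<lambda>_. \<Omega>). (\<Sum>a\<in>J. (H a w)\<^sup>2)\<^sup>2)"
      by (simp add: sum_distrib_left)
    also have "\<dots> \<le> M * C * ((M * C) ^ card I * (\<Sum>a\<in>J. \<sigma> a)\<^sup>2)"
      using assms(3,4) IH4 by (intro mult_left_mono sum_square_sum_squares_le) (auto simp: \<sigma>_def sum_nonneg)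
    also have "\<dots> = (M * C) ^ card (insert i I) * (\<Sum>a\<in>J. \<sigma> a)\<^sup>2"
      using insert.hyps by simp
    finally have four: "(\<Sum>w\<in>PiE I (\<lambda>_. \<Omega>). \<Sum>y\<in>\<Omega>. (\<Sum>a\<in>J. H a w * \<phi> a y) ^ 4)
        \<le> (M * C) ^ card (insert i I) * (\<Sum>a\<in>J. \<sigma> a)\<^sup>2" .
    have red: "(\<Sum>w\<in>PiE (insert i I) (\<lambda>_. \<Omega>).
          (\<Sum>g\<in>PiE (insert i I) (\<lambda>_. J). c g * (\<Prod>j\<in>insert i I. \<phi> (g j) (w j))) ^ k)
        = (\<Sum>w\<in>PiE I (\<lambda>_. \<Omega>). \<Sum>y\<in>\<Omega>. (\<Sum>a\<in>J. H a w * \<phi> a y) ^ k)" for k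
      by (subst sum_PiE_insert[OF insert.hyps(2)]) (simp only: F)
    show ?case using two four by (simp only: red \<sigma>)
  qed
  then show "(\<Sum>w\<in>PiE I (\<lambda>_. \<Omega>). (\<Sum>g\<in>PiE I (\<lambda>_. J). c g * (\<Prod>i\<in>I. \<phi> (g i) (w i)))\<^sup>2)
           = M ^ card I * (\<Sum>g\<in>PiE I (\<lambda>_. J). (c g)\<^sup>2)"
    and "(\<Sum>w\<in>PiE I (\<lambda>_. \<Omega>). (\<Sum>g\<in>PiE I (\<lambda>_. J). c g * (\<Prod>i\<in>I. \<phi> (g i) (w i))) ^ 4)
           \<le> (M * C) ^ card I * (\<Sum>g\<in>PiE I (\<lambda>_. J). (c g)\<^sup>2)\<^sup>2"
    by auto
qed

text \<open>The weight \<open>\<alpha> = 2 / (4 - q)\<close> solves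
  \<open>q * \<alpha> + 4 * (1 - \<alpha>) = 2\<close>, so the square is a weighted geometric mean
  of the \<open>q\<close>-th and fourth powers; Young's inequality bounds it by the arithmetic mean.
  The additive form can be summed without Hoelder's inequality.\<close>

lemma square_le_interpolation:
  fixes u q :: real
  assumes "0 \<le> u" "0 < q" "q \<le> 1"
  shows "u\<^sup>2 \<le> 2 / (4 - q) * u powr q + (1 - 2 / (4 - q)) * u ^ 4"
proof (cases "u = 0")
  case False
  then have u: "u > 0" using assms by simp
  define \<alpha> where "\<alpha> = 2 / (4 - q)"
  have \<alpha>: "0 \<le> \<alpha>" "0 \<le> 1 - \<alpha>" "\<alpha> + (1 - \<alpha>) = 1" "q * \<alpha> + 4 * (1 - \<alpha>) = 2"
  proof -
    have "(4 - q) * \<alpha> = 2" using assms by (simp add: \<alpha>_def divide_simps)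
    moreover have "0 \<le> \<alpha>" "\<alpha> \<le> 1" using assms by (auto simp: \<alpha>_def)
    ultimately show "0 \<le> \<alpha>" "0 \<le> 1 - \<alpha>" "\<alpha> + (1 - \<alpha>) = 1" "q * \<alpha> + 4 * (1 - \<alpha>) = 2"
      by (auto simp: algebra_simps)
  qed
  have "u\<^sup>2 = u powr (q * \<alpha> + 4 * (1 - \<alpha>))" unfolding \<alpha>(4) using u by simp
  also have "\<dots> = (u powr q) powr \<alpha> * (u ^ 4) powr (1 - \<alpha>)"
    using u by (simp add: powr_add powr_powr powr_numeral[symmetric] del: powr_numeral)
  also have "\<dots> \<le> \<alpha> * (u powr q) + (1 - \<alpha>) * u ^ 4"
    using u \<alpha> by (intro Youngs_inequality_0) auto
  finally show ?thesis by (simp add: \<alpha>_def)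
qed simp

text \<open>A small fourth moment prevents the second moment from sitting on a few large values of
  \<open>F\<close>, so the \<open>q\<close>-th moment cannot be small either. The interpolation
  inequality is summed over \<Omega> after rescaling \<open>F\<close>.\<close>

lemma powr_moment_ge:
  fixes F :: "'w \<Rightarrow> real"
  assumes q: "0 < q" "q \<le> 1" and "0 < v" "0 < C"
    and two: "(\<Sum>w\<in>\<Omega>. (F w)\<^sup>2) = M * v"
    and four: "(\<Sum>w\<in>\<Omega>. F w ^ 4) \<le> M * C * v\<^sup>2"
  shows "M * ((v * C) powr (q / 2) / C) \<le> (\<Sum>w\<in>\<Omega>. \<bar>F w\<bar> powr q)"
proof -
  define \<alpha> where "\<alpha> = 2 / (4 - q)"
  \<comment> \<open>With this scale the second moment of \<open>u\<close> equals
    \<open>M / C\<close> and the fourth is at most \<open>M / C\<close>, so the interpolation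
    weights cancel.\<close>
  define l where "l = sqrt (v * C)"
  define u where "u = (\<lambda>w. \<bar>F w\<bar> / l)"
  have \<alpha>: "0 < \<alpha>" "\<alpha> \<le> 1" using q by (auto simp: \<alpha>_def)
  have l: "0 < l" "l\<^sup>2 = v * C" using assms by (auto simp: l_def)
  have l4: "l ^ 4 = v\<^sup>2 * C\<^sup>2"
    using l(2) by (metis mult_2 numeral_Bit0 power_add power_mult_distrib power2_eq_square)
  have u2: "(\<Sum>w\<in>\<Omega>. (u w)\<^sup>2) = M / C"
    using assms by (simp add: u_def power_divide l sum_divide_distrib[symmetric])
  have "(\<Sum>w\<in>\<Omega>. (u w) ^ 4) = (\<Sum>w\<in>\<Omega>. F w ^ 4) / (v\<^sup>2 * C\<^sup>2)"
    by (simp add: u_def power_divide l4 sum_divide_distrib[symmetric])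
  also have "\<dots> \<le> (M * C * v\<^sup>2) / (v\<^sup>2 * C\<^sup>2)"
    by (intro divide_right_mono four) simp
  also have "\<dots> = M / C" using assms by (simp add: power2_eq_square)
  finally have u4: "(\<Sum>w\<in>\<Omega>. (u w) ^ 4) \<le> M / C" .
  have "M / C \<le> (\<Sum>w\<in>\<Omega>. \<alpha> * u w powr q + (1 - \<alpha>) * u w ^ 4)"
    unfolding u2[symmetric] \<alpha>_def using q l by (intro sum_mono square_le_interpolation) (auto simp: u_def)
  also have "\<dots> \<le> \<alpha> * (\<Sum>w\<in>\<Omega>. u w powr q) + (1 - \<alpha>) * (M / C)"
    unfolding sum.distrib sum_distrib_left[symmetric]
    using u4 \<alpha> by (intro add_left_mono mult_left_mono) auto
  finally have "\<alpha> * (M / C) \<le> \<alpha> * (\<Sum>w\<in>\<Omega>. u w powr q)"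
    using left_diff_distrib[of 1 \<alpha> "M / C"] by simp
  then have "M / C \<le> (\<Sum>w\<in>\<Omega>. u w powr q)"
    using mult_le_cancel_left_pos[OF \<alpha>(1)] by blast
  then have "l powr q * (M / C) \<le> l powr q * (\<Sum>w\<in>\<Omega>. u w powr q)"
    by (rule mult_left_mono) simp
  also have "\<dots> = (\<Sum>w\<in>\<Omega>. \<bar>F w\<bar> powr q)"
    using l by (simp add: u_def sum_distrib_left powr_divide)
  also have "l powr q = (v * C) powr (q / 2)"
    using assms by (simp add: l_def powr_half_sqrt[symmetric] powr_powr)
  finally show ?thesis by (simp add: ac_simps)
qed

subsection \<open>Binary digits and dyadic shifts\<close>

lemma xor_div_2: "(e XOR V) div 2 = (e div 2) XOR (V div 2 :: nat)"
  by (metis drop_bit_Suc drop_bit_0 drop_bit_xor id_apply)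

lemma odd_xor_iff: "odd (e XOR V) \<longleftrightarrow> odd e \<noteq> odd (V::nat)"
  by (simp add: even_xor_iff)

lemma xor_less_power:
  fixes e V :: nat
  assumes "e < 2 ^ s" "V < 2 ^ s"
  shows "e XOR V < 2 ^ s"
  using assms by (metis take_bit_nat_eq_self_iff take_bit_xor)

text \<open>\<open>e XOR V\<close> and \<open>V\<close> first differ at the leading one of
  \<open>e\<close>, and \<open>e XOR V\<close> is the smaller exactly if \<open>V\<close> has digit
  1 there. The condition \<open>e div 2 ^ (s - a) = 1\<close> locates this leading one at position
  \<open>a\<close>, and \<open>(1 - rademacher s a V) / 2\<close> is the \<open>a\<close>-th digit
  of \<open>V\<close>.\<close>

lemma of_bool_xor_less:
  assumes "e < 2 ^ s"
  shows "(of_bool (e XOR V < V) :: real)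
    = (\<Sum>a=1..s. of_bool (e div 2 ^ (s - a) = 1) * (1 - rademacher s a V)) / 2"
  using assms
proof (induction s arbitrary: e V)
  case (Suc s)
  define e' b V' c where defs: "e' = e div 2" "b = e mod 2" "V' = V div 2" "c = V mod 2"
  have e: "e = 2 * e' + b" "b < 2" and V: "V = 2 * V' + c" "c < 2" by (auto simp: defs)
  have e': "e' < 2 ^ s" using Suc.prems by (simp add: defs less_mult_imp_div_less)
  have x: "e XOR V = 2 * (e' XOR V') + (b + c) mod 2"
  proof -
    have "(e XOR V) div 2 = e' XOR V'" by (simp add: xor_div_2 defs)
    moreover have "(e XOR V) mod 2 = (b + c) mod 2"
      using odd_xor_iff[of e V] unfolding defs by (metis (no_types) mod_add_eq even_add odd_iff_mod_2_eq_one even_iff_mod_2_eq_zero)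
    ultimately show ?thesis by (metis mult_div_mod_eq)
  qed
  have eq: "e' XOR V' = V' \<longleftrightarrow> e' = 0"
    by (metis xor.assoc xor.left_neutral xor.right_neutral xor_self_eq)
  \<comment> \<open>Lexicographic comparison: the lowest digits matter only if the higher parts
    agree, that is, if \<open>e' = 0\<close>.\<close>
  have "e XOR V < V \<longleftrightarrow> e' XOR V' < V' \<or> (e' = 0 \<and> b = 1 \<and> c = 1)"
  proof -
    have "e XOR V < V \<longleftrightarrow> e' XOR V' < V' \<or> (e' XOR V' = V' \<and> (b + c) mod 2 < c)"
    proof -
      have "2 * p + r < 2 * v + c \<longleftrightarrow> p < v \<or> (p = v \<and> r < c)" if "r < 2" for p r v :: nat
        using that V(2) by arith
      from this[of "(b + c) mod 2" "e' XOR V'" V'] show ?thesis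
        unfolding x V(1)[symmetric] by simp
    qed
    moreover have "(b + c) mod 2 < c \<longleftrightarrow> b = 1 \<and> c = 1"
      using e(2) V(2) by (auto simp: less_2_cases_iff)
    ultimately show ?thesis using eq by simp
  qed
  \<comment> \<open>The two alternatives exclude each other, so the indicator of their disjunction
    is the sum of their indicators.\<close>
  moreover have "\<not> (e' XOR V' < V') \<or> e' \<noteq> 0" using eq by auto
  ultimately have "(of_bool (e XOR V < V) :: real)
      = of_bool (e' XOR V' < V') + of_bool (e' = 0 \<and> b = 1) * (1 - (-1) ^ V) / 2"
    using V e(2) by (auto simp: less_2_cases_iff)
  also have "of_bool (e' = 0 \<and> b = 1) * (1 - (-1) ^ V)
      = of_bool (e div 2 ^ (Suc s - Suc s) = 1) * (1 - rademacher (Suc s) (Suc s) V)"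
  proof -
    have "e' = 0 \<and> b = 1 \<longleftrightarrow> e = 1" using e by arith
    then show ?thesis by (simp add: rademacher_top)
  qed
  also have "of_bool (e' XOR V' < V') = (\<Sum>a=1..s. of_bool (e' div 2 ^ (s - a) = 1) * (1 - rademacher s a V')) / 2"
    by (rule Suc.IH[OF e'])
  also have "\<dots> = (\<Sum>a=1..s. of_bool (e div 2 ^ (Suc s - a) = 1) * (1 - rademacher (Suc s) a V)) / 2"
  proof (intro arg_cong2[where f = "(/)"] sum.cong refl)
    fix a assume "a \<in> {1..s}"
    then have "e div 2 ^ (Suc s - a) = e' div 2 ^ (s - a)"
      by (simp add: defs Suc_diff_le div_mult2_eq)
    then show "of_bool (e' div 2 ^ (s - a) = 1) * (1 - rademacher s a V')
        = of_bool (e div 2 ^ (Suc s - a) = 1) * (1 - rademacher (Suc s) a V)"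
      using \<open>a \<in> {1..s}\<close> V rademacher_Suc[of a s c V'] by simp
  qed
  finally show ?case by (simp add: add_divide_distrib)
qed simp

lemma rademacher_binary_expansion:
  assumes "V < 2 ^ s"
  shows "real V = (\<Sum>a=1..s. 2 ^ (s - a) * (1 - rademacher s a V)) / 2"
  using assms
proof (induction s arbitrary: V)
  case (Suc s)
  define V' c where defs: "V' = V div 2" "c = V mod 2"
  have V: "V = 2 * V' + c" "c < 2" by (auto simp: defs)
  have "V' < 2 ^ s" using Suc.prems by (simp add: defs less_mult_imp_div_less)
  then have "real V' = (\<Sum>a=1..s. 2 ^ (s - a) * (1 - rademacher s a V')) / 2" by (rule Suc.IH)
  then have "2 * real V' = (\<Sum>a=1..s. 2 * (2 ^ (s - a) * (1 - rademacher s a V'))) / 2"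
    unfolding sum_distrib_left[symmetric] by simp
  also have "\<dots> = (\<Sum>a=1..s. 2 ^ (Suc s - a) * (1 - rademacher (Suc s) a V)) / 2"
  proof (intro arg_cong2[where f = "(/)"] sum.cong refl)
    fix a assume "a \<in> {1..s}"
    then show "2 * (2 ^ (s - a) * (1 - rademacher s a V')) = (2 ^ (Suc s - a) * (1 - rademacher (Suc s) a V) :: real)"
      using V rademacher_Suc[of a s c V'] by (simp add: Suc_diff_le)
  qed
  finally have "2 * real V' = (\<Sum>a=1..s. 2 ^ (Suc s - a) * (1 - rademacher (Suc s) a V)) / 2" .
  moreover have "real c = (1 - rademacher (Suc s) (Suc s) V) / 2"
    using V by (auto simp: rademacher_top less_2_cases_iff)
  moreover have "real V = 2 * real V' + real c" using V by simp
  ultimately show ?case by simp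
qed simp

lemma floor_div_power:
  assumes "0 \<le> f" "f < 1"
  shows "\<lfloor>(real K + f) / 2 ^ n\<rfloor> = int (K div 2 ^ n)"
proof -
  have "\<lfloor>(real K + f) / of_int (2 ^ n)\<rfloor> = \<lfloor>real K + f\<rfloor> div 2 ^ n"
    by (rule floor_divide_real_eq_div) simp
  moreover have "\<lfloor>real K + f\<rfloor> = int K" using assms by (simp add: floor_eq_iff)
  ultimately show ?thesis by (simp add: zdiv_int)
qed

text \<open>Digits beyond the scale \<open>s\<close> are those of the fractional part \<open>f\<close>, which the shift leaves alone.\<close>

lemma dyadic_digit_split:
  assumes "0 \<le> f" "f < 1" "K < 2 ^ s"
  shows "dyadic_digit a ((real K + f) / 2 ^ s)
    = (if a \<le> s then of_bool (bit K (s - a)) else nat (\<lfloor>f * 2 ^ (a - s)\<rfloor> mod 2))"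
proof -
  have "real K + 1 \<le> 2 ^ s" using assms(3)
    by (metis Suc_leI add.commute of_nat_Suc of_nat_le_iff of_nat_numeral of_nat_power)
  then have "0 \<le> (real K + f) / 2 ^ s" "(real K + f) / 2 ^ s < 1" using assms by auto
  then have d: "dyadic_digit a ((real K + f) / 2 ^ s) = nat (\<lfloor>(real K + f) / 2 ^ s * 2 ^ a\<rfloor> mod 2)"
    by (rule dyadic_digit_floor)
  show ?thesis
  proof (cases "a \<le> s")
    case True
    then have "(real K + f) / 2 ^ s * 2 ^ a = (real K + f) / 2 ^ (s - a)"
      by (simp add: power_diff)
    then show ?thesis
      using True by (simp add: d floor_div_power[OF assms(1,2)] bit_iff_odd mod_2_eq_odd)
  next
    case False
    then have "(2::real) ^ a = 2 ^ s * 2 ^ (a - s)" by (simp flip: power_add)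
    then have "(real K + f) / 2 ^ s * 2 ^ a = (real K + f) * 2 ^ (a - s)" by simp
    then have "(real K + f) / 2 ^ s * 2 ^ a = of_int (int K * 2 ^ (a - s)) + f * 2 ^ (a - s)"
      by (simp add: distrib_right)
    then have "\<lfloor>(real K + f) / 2 ^ s * 2 ^ a\<rfloor> = int K * 2 ^ (a - s) + \<lfloor>f * 2 ^ (a - s)\<rfloor>"
      by (metis floor_add_int add.commute)
    moreover have "even (int K * 2 ^ (a - s))" using False by simp
    ultimately show ?thesis using False d by (auto simp: mod_2_eq_odd)
  qed
qed

text \<open>Digitwise addition without carries is XOR on the first \<open>s\<close> digits, while
  the shift has only zero digits beyond them. The candidate has the right digits, and
  \<open>dyadic_add_ex1\<close> makes it the only one.\<close>

lemma dyadic_add_xor: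
  assumes "0 \<le> f" "f < 1" "k < 2 ^ s" "T < 2 ^ s"
  shows "dyadic_add ((real k + f) / 2 ^ s) (real T / 2 ^ s) = (real (k XOR T) + f) / 2 ^ s"
proof -
  let ?x = "(real k + f) / 2 ^ s" and ?t = "real T / 2 ^ s" and ?z = "(real (k XOR T) + f) / 2 ^ s"
  have unit: "0 \<le> (real K + f) / 2 ^ s \<and> (real K + f) / 2 ^ s < 1" if "K < 2 ^ s" for K
  proof -
    have "real K + 1 \<le> 2 ^ s" using that
      by (metis Suc_leI add.commute of_nat_Suc of_nat_le_iff of_nat_numeral of_nat_power)
    then show ?thesis using assms by auto
  qed
  have t: "?t \<in> dyadic_rationals s"
    using assms(4) by (auto simp: dyadic_rationals_def)
  have K: "k XOR T < 2 ^ s" by (rule xor_less_power[OF assms(3,4)])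
  have "dyadic_digit a ?z = (dyadic_digit a ?x + dyadic_digit a ?t) mod 2" for a
    using dyadic_digit_split[OF assms(1,2) K, of a] dyadic_digit_split[OF assms(1,2,3), of a]
      dyadic_digit_split[of 0 T s a, simplified, OF assms(4)]
    by (auto simp: bit_xor_iff mod_2_eq_odd)
  then show ?thesis
    unfolding dyadic_add_def
    using unit[OF assms(3)] unit[OF K]
    by (intro the1_equality dyadic_add_ex1[OF _ _ t]) auto
qed

subsection \<open>The dyadic grid\<close>

definition grid_point :: "nat \<Rightarrow> ('n \<Rightarrow> nat) \<Rightarrow> real ^ 'n" where
  "grid_point s m = (\<chi> i. real (m i) / 2 ^ s)"

definition grid_cell :: "nat \<Rightarrow> (real ^ 'n) set" where
  "grid_cell s = {R. \<forall>i. 0 \<le> R $ i \<and> R $ i < 1 / 2 ^ s}"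

text \<open>The form \<open>PiE UNIV\<close> is the one over which \<open>tensor_moments\<close>
  sums. The same index set serves for shifts and for the cells of the cube.\<close>

definition grid_indices :: "nat \<Rightarrow> ('n \<Rightarrow> nat) set" where
  "grid_indices s = PiE UNIV (\<lambda>_. {..<2 ^ s})"

lemma grid_indices_iff: "m \<in> grid_indices s \<longleftrightarrow> (\<forall>i. m i < 2 ^ s)"
  by (auto simp: grid_indices_def PiE_iff)

lemma finite_grid_indices [simp]: "finite (grid_indices s :: ('n::finite \<Rightarrow> nat) set)"
  by (simp add: grid_indices_def finite_PiE)

lemma card_grid_indices: "card (grid_indices s :: ('n::finite \<Rightarrow> nat) set) = 2 ^ (CARD('n) * s)"
  by (simp add: grid_indices_def card_PiE power_mult mult.commute[of _ s])

lemma of_nat_le_two_power_minus_1_iff: "real m \<le> 2 ^ s - 1 \<longleftrightarrow> m < 2 ^ s"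
proof -
  have "real m \<le> 2 ^ s - 1 \<longleftrightarrow> real (Suc m) \<le> real (2 ^ s)" by auto
  also have "\<dots> \<longleftrightarrow> m < 2 ^ s" by (simp only: of_nat_le_iff Suc_le_eq)
  finally show ?thesis .
qed

lemma bij_betw_grid_point: "bij_betw (grid_point s) (grid_indices s) (dyadic_vectors s)"
  unfolding bij_betw_def
proof
  show "inj_on (grid_point s) (grid_indices s)"
    by (auto simp: inj_on_def grid_point_def vec_eq_iff)
  show "grid_point s ` grid_indices s = dyadic_vectors s"
  proof
    show "grid_point s ` grid_indices s \<subseteq> dyadic_vectors s"
    proof
      fix T :: "real ^ 'n" assume "T \<in> grid_point s ` grid_indices s"
      then obtain m where m: "\<And>i. T $ i = real (m i) / 2 ^ s" "\<And>i. m i < 2 ^ s"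
        by (auto simp: grid_point_def grid_indices_iff)
      have "m i \<le> 2 ^ s - 1" for i using m(2)[of i] by simp
      then show "T \<in> dyadic_vectors s"
        using m(1) by (auto simp: dyadic_vectors_def dyadic_rationals_def)
    qed
    show "dyadic_vectors s \<subseteq> grid_point s ` grid_indices s"
    proof
      fix T :: "real ^ 'n" assume "T \<in> dyadic_vectors s"
      then have "\<forall>i. \<exists>m. T $ i = real m / 2 ^ s \<and> m \<le> 2 ^ s - 1"
        by (auto simp: dyadic_vectors_def dyadic_rationals_def)
      then obtain m where m: "\<And>i. T $ i = real (m i) / 2 ^ s" "\<And>i. m i \<le> 2 ^ s - 1"
        by metis
      have "m i < 2 ^ s" for i
        using m(2)[of i] by (simp add: le_diff_conv2 Suc_le_eq[symmetric])
      then show "T \<in> grid_point s ` grid_indices s"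
        using m(1) by (intro image_eqI[of _ _ m]) (auto simp: grid_point_def vec_eq_iff grid_indices_iff)
    qed
  qed
qed

lemma card_dyadic_vectors: "card (dyadic_vectors s :: (real ^ 'n) set) = 2 ^ (CARD('n) * s)"
  by (metis bij_betw_grid_point bij_betw_same_card card_grid_indices)

lemma borel_unit_cube [measurable]: "(unit_cube :: (real ^ 'n) set) \<in> sets borel"
proof -
  have "unit_cube = (\<Inter>i. {X :: real ^ 'n. 0 \<le> X $ i \<and> X $ i < 1})"
    by (auto simp: unit_cube_def)
  also have "\<dots> \<in> sets borel" by measurable
  finally show ?thesis .
qed

lemma borel_grid_cell [measurable]: "(grid_cell s :: (real ^ 'n) set) \<in> sets borel"
proof -
  have "grid_cell s = (\<Inter>i. {X :: real ^ 'n. 0 \<le> X $ i \<and> X $ i < 1 / 2 ^ s})"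
    by (auto simp: grid_cell_def)
  also have "\<dots> \<in> sets borel" by measurable
  finally show ?thesis .
qed

lemma emeasure_unit_cube: "emeasure lborel (unit_cube :: (real ^ 'n) set) = 1"
proof (rule antisym)
  have One: "(One :: real ^ 'n) $ i = 1" for i
    using inner_sum_left_Basis[of "axis i 1 :: real ^ 'n" "\<lambda>_. 1"]
    by (simp add: cart_eq_inner_axis axis_in_Basis_iff)
  have sub: "unit_cube \<subseteq> cbox 0 (One :: real ^ 'n)" "box 0 (One :: real ^ 'n) \<subseteq> unit_cube"
    by (auto simp: unit_cube_def mem_box_cart less_imp_le One simp del: sum_component)
  show "emeasure lborel (unit_cube :: (real ^ 'n) set) \<le> 1" "1 \<le> emeasure lborel (unit_cube :: (real ^ 'n) set)"
    using emeasure_mono[OF sub(1), of lborel] emeasure_mono[OF sub(2), of lborel]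
    by (simp_all add: emeasure_lborel_cbox_eq emeasure_lborel_box_eq)
qed

text \<open>The translated half-open cells partition the cube, and the index of the cell containing
  \<open>Y\<close> is read off from the first \<open>s\<close> digits of each coordinate.\<close>

lemma in_grid_cell_iff:
  fixes Y :: "real ^ 'n"
  assumes "m \<in> grid_indices s"
  shows "Y - grid_point s m \<in> grid_cell s \<longleftrightarrow> Y \<in> unit_cube \<and> m = (\<lambda>i. nat \<lfloor>Y $ i * 2 ^ s\<rfloor>)"
proof -
  have "0 \<le> Y $ i - real (m i) / 2 ^ s \<and> Y $ i - real (m i) / 2 ^ s < 1 / 2 ^ s
    \<longleftrightarrow> 0 \<le> Y $ i \<and> Y $ i < 1 \<and> m i = nat \<lfloor>Y $ i * 2 ^ s\<rfloor>" (is "?A \<longleftrightarrow> ?B") for i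
  proof -
    have m: "real (m i) \<le> 2 ^ s - 1"
      using assms by (simp add: grid_indices_iff of_nat_le_two_power_minus_1_iff)
    have "?A \<longleftrightarrow> real (m i) \<le> Y $ i * 2 ^ s \<and> Y $ i * 2 ^ s < real (m i) + 1"
      by (simp add: pos_divide_le_eq pos_less_divide_eq diff_less_eq add.commute flip: add_divide_distrib)
    also have "\<dots> \<longleftrightarrow> ?B"
    proof
      assume *: "real (m i) \<le> Y $ i * 2 ^ s \<and> Y $ i * 2 ^ s < real (m i) + 1"
      then have "0 \<le> Y $ i * 2 ^ s" "Y $ i * 2 ^ s < 1 * 2 ^ s" using m by linarith+
      moreover have "(0::real) < 2 ^ s" by simp
      ultimately have "0 \<le> Y $ i" "Y $ i < 1"
        using mult_less_cancel_right_pos[of "2 ^ s" "Y $ i" 1] by (auto simp: zero_le_mult_iff)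
      moreover have "\<lfloor>Y $ i * 2 ^ s\<rfloor> = int (m i)" using * by (simp add: floor_eq_iff)
      ultimately show ?B by simp
    next
      assume B: ?B
      then have "real (m i) = of_int \<lfloor>Y $ i * 2 ^ s\<rfloor>" by simp
      then show "real (m i) \<le> Y $ i * 2 ^ s \<and> Y $ i * 2 ^ s < real (m i) + 1" by linarith
    qed
    finally show ?thesis .
  qed
  then show ?thesis
    by (auto simp: grid_cell_def grid_point_def unit_cube_def fun_eq_iff)
qed

lemma indicator_unit_cube_decompose:
  "indicator unit_cube Y = (\<Sum>m\<in>grid_indices s. indicator (grid_cell s) (Y - grid_point s m) :: real)"
    for Y :: "real ^ 'n"
proof (cases "Y \<in> unit_cube")
  case True
  define m0 where "m0 = (\<lambda>i. nat \<lfloor>Y $ i * 2 ^ s\<rfloor>)"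
  have "m0 i < 2 ^ s" for i
  proof -
    have "0 \<le> Y $ i * 2 ^ s" "Y $ i * 2 ^ s < 1 * 2 ^ s"
      using True by (auto simp: unit_cube_def)
    then have "\<lfloor>Y $ i * 2 ^ s\<rfloor> < 2 ^ s" by (simp add: floor_less_iff)
    then show ?thesis unfolding m0_def by (simp add: nat_less_iff \<open>0 \<le> Y $ i * 2 ^ s\<close>)
  qed
  then have "m0 \<in> grid_indices s" by (simp add: grid_indices_iff)
  have "(\<Sum>m\<in>grid_indices s. indicator (grid_cell s) (Y - grid_point s m) :: real)
      = (\<Sum>m\<in>grid_indices s. if m = m0 then 1 else 0)"
    using True by (intro sum.cong refl) (auto simp: indicator_def in_grid_cell_iff m0_def)
  then show ?thesis using \<open>m0 \<in> grid_indices s\<close> True by simp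
next
  case False
  then show ?thesis by (simp add: indicator_def in_grid_cell_iff)
qed

section \<open>Folding an integral over the cube onto one cell\<close>

lemma lborel_integral_translation:
  fixes f :: "'a::euclidean_space \<Rightarrow> real"
  assumes [measurable]: "f \<in> borel_measurable borel"
  shows "(LINT x|lborel. f x) = (LINT x|lborel. f (t + x))"
  by (subst (1) lborel_distr_plus[of t, symmetric], subst integral_distr) auto

lemma integrable_lborel_translation:
  fixes f :: "'a::euclidean_space \<Rightarrow> real"
  assumes "integrable lborel f"
  shows "integrable lborel (\<lambda>x. f (t + x))"
proof -
  have [measurable]: "f \<in> borel_measurable borel"
    using borel_measurable_integrable[OF assms] by simp
  have "integrable (distr lborel borel ((+) t)) f" using assms by (simp add: lborel_distr_plus)
  then show ?thesis by (subst (asm) integrable_distr_eq) auto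
qed

text \<open>Split the cube into its cells and move each to the origin by translation invariance. The
  sum over \<open>m\<close> then runs through the first \<open>s\<close> digits of \<open>Y\<close>
  while \<open>R\<close> carries the remaining ones.\<close>

lemma unit_cube_integral_decompose:
  fixes f :: "real ^ 'n \<Rightarrow> real"
  assumes f: "set_integrable lborel unit_cube f" and [measurable]: "f \<in> borel_measurable borel"
  shows "integrable lborel (\<lambda>R. indicator (grid_cell s) R * (\<Sum>m\<in>grid_indices s. f (grid_point s m + R)))"
    and "(LINT Y:unit_cube|lborel. f Y)
      = (LINT R|lborel. indicator (grid_cell s) R * (\<Sum>m\<in>grid_indices s. f (grid_point s m + R)))"
proof -
  define g where "g = (\<lambda>m Y. indicator (grid_cell s) (Y - grid_point s m) * f Y)"
  have [measurable]: "g m \<in> borel_measurable borel" for m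
    unfolding g_def by measurable
  have int_f: "integrable lborel (\<lambda>Y. indicator unit_cube Y * f Y)"
    using f by (simp add: set_integrable_def)
  have int_g: "integrable lborel (g m)" if "m \<in> grid_indices s" for m
  proof (rule Bochner_Integration.integrable_bound[OF int_f])
    show "AE Y in lborel. norm (g m Y) \<le> norm (indicator unit_cube Y * f Y)"
      using that by (intro always_eventually) (auto simp: g_def indicator_def in_grid_cell_iff)
  qed simp
  have shift: "g m (grid_point s m + R) = indicator (grid_cell s) R * f (grid_point s m + R)" for m R
    by (simp add: g_def)
  have int': "integrable lborel (\<lambda>R. indicator (grid_cell s) R * f (grid_point s m + R))"
    if "m \<in> grid_indices s" for m
    using integrable_lborel_translation[OF int_g[OF that], of "grid_point s m"] by (simp only: shift)
  then show "integrable lborel (\<lambda>R. indicator (grid_cell s) R * (\<Sum>m\<in>grid_indices s. f (grid_point s m + R)))"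
    unfolding sum_distrib_left by (intro Bochner_Integration.integrable_sum)
  have "(LINT Y:unit_cube|lborel. f Y) = (LINT Y|lborel. (\<Sum>m\<in>grid_indices s. g m Y))"
    unfolding set_lebesgue_integral_def g_def sum_distrib_right[symmetric]
    by (simp add: indicator_unit_cube_decompose[of _ s])
  also have "\<dots> = (\<Sum>m\<in>grid_indices s. LINT Y|lborel. g m Y)"
    by (intro Bochner_Integration.integral_sum int_g)
  also have "\<dots> = (\<Sum>m\<in>grid_indices s. (LINT R|lborel. indicator (grid_cell s) R * f (grid_point s m + R)))"
    unfolding shift[symmetric] by (intro sum.cong refl lborel_integral_translation) simp
  also have "\<dots> = (LINT R|lborel. indicator (grid_cell s) R * (\<Sum>m\<in>grid_indices s. f (grid_point s m + R)))"
    unfolding sum_distrib_left by (intro Bochner_Integration.integral_sum[symmetric] int')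
  finally show "(LINT Y:unit_cube|lborel. f Y)
      = (LINT R|lborel. indicator (grid_cell s) R * (\<Sum>m\<in>grid_indices s. f (grid_point s m + R)))" .
qed

lemma set_integrable_const_unit_cube: "set_integrable lborel (unit_cube :: (real ^ 'n) set) (\<lambda>_. b :: real)"
  unfolding set_integrable_def
  by (simp add: emeasure_unit_cube)

text \<open>Reduces an integral bound to a discrete one that holds for every fixed choice of the
  digits beyond \<open>s\<close>.\<close>

lemma unit_cube_integral_ge:
  fixes f :: "real ^ 'n \<Rightarrow> real"
  assumes f: "set_integrable lborel unit_cube f" and meas: "f \<in> borel_measurable borel"
    and ge: "\<And>R. R \<in> grid_cell s \<Longrightarrow> 2 ^ (CARD('n) * s) * b \<le> (\<Sum>m\<in>grid_indices s. f (grid_point s m + R))"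
  shows "b \<le> (LINT Y:unit_cube|lborel. f Y)"
proof -
  have "b = (LINT Y:(unit_cube :: (real ^ 'n) set)|lborel. b)"
    by (simp add: set_lebesgue_integral_def measure_def emeasure_unit_cube)
  \<comment> \<open>Decomposing the constant \<open>b\<close> in the same way as \<open>f\<close>
    avoids computing the volume of a cell.\<close>
  also have "\<dots> = (LINT R :: real ^ 'n|lborel. indicator (grid_cell s) R * (\<Sum>m\<in>(grid_indices s :: ('n \<Rightarrow> nat) set). b))"
    using unit_cube_integral_decompose(2)[OF set_integrable_const_unit_cube, of b s] by simp
  also have "\<dots> \<le> (LINT R|lborel. indicator (grid_cell s) R * (\<Sum>m\<in>grid_indices s. f (grid_point s m + R)))"
  proof (rule integral_mono)
    show "integrable lborel (\<lambda>R :: real ^ 'n. indicator (grid_cell s) R * (\<Sum>m\<in>(grid_indices s :: ('n \<Rightarrow> nat) set). b))"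
      using unit_cube_integral_decompose(1)[OF set_integrable_const_unit_cube, of b s] by simp
    show "integrable lborel (\<lambda>R. indicator (grid_cell s) R * (\<Sum>m\<in>grid_indices s. f (grid_point s m + R)))"
      by (rule unit_cube_integral_decompose(1)[OF f meas])
    show "indicator (grid_cell s) R * (\<Sum>m\<in>(grid_indices s :: ('n \<Rightarrow> nat) set). b)
        \<le> indicator (grid_cell s) R * (\<Sum>m\<in>grid_indices s. f (grid_point s m + R))" for R
      using ge[of R] by (simp add: indicator_def card_grid_indices)
  qed
  also have "\<dots> = (LINT Y:unit_cube|lborel. f Y)"
    by (rule unit_cube_integral_decompose(2)[OF f meas, symmetric])
  finally show ?thesis .
qed

subsection \<open>The local discrepancy as a chaos\<close>

text \<open>
  The expansion of the indicator of \<open>x \<oplus> t < y\<close>. For \<open>a \<ge> 1\<close>, the condition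
  \<open>e div 2 ^ (s - a) = 1\<close> says that \<open>x\<close> and \<open>w\<close> first differ in their \<open>a\<close>-th digit. The coefficient
  of the constant function \<open>a = 0\<close> also absorbs the comparison of the digits beyond \<open>s\<close>.
\<close>

definition indicator_coeff :: "nat \<Rightarrow> nat \<Rightarrow> real \<Rightarrow> real \<Rightarrow> nat \<Rightarrow> real" where
  "indicator_coeff s w r x a =
    (let e = nat \<lfloor>x * 2 ^ s\<rfloor> XOR w in
     if a = 0 then (\<Sum>a=1..s. of_bool (e div 2 ^ (s - a) = 1)) / 2 + of_bool (e = 0 \<and> frac (x * 2 ^ s) < r * 2 ^ s)
     else - of_bool (e div 2 ^ (s - a) = 1) / 2)"

text \<open>The Rademacher coefficients of \<open>real v / 2 ^ s + r\<close> as a function of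
  \<open>v\<close>: the \<open>a\<close>-th digit \<open>(1 - rademacher s a v) / 2\<close> has
  weight \<open>1 / 2 ^ a\<close>, and index 0 gathers the constant parts.\<close>

definition coordinate_coeff :: "nat \<Rightarrow> real \<Rightarrow> nat \<Rightarrow> real" where
  "coordinate_coeff s r a = (if a = 0 then (\<Sum>a=1..s. 1 / 2 ^ a) / 2 + r else - (1 / 2 ^ a) / 2)"

section \<open>Expansions in a single coordinate\<close>

lemma unit_interval_split:
  fixes x :: real
  assumes "0 \<le> x" "x < 1"
  shows "x = (real (nat \<lfloor>x * 2 ^ s\<rfloor>) + frac (x * 2 ^ s)) / 2 ^ s" "nat \<lfloor>x * 2 ^ s\<rfloor> < 2 ^ s"
proof -
  have "0 \<le> x * 2 ^ s" "x * 2 ^ s < 1 * 2 ^ s" using assms by auto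
  then show "x = (real (nat \<lfloor>x * 2 ^ s\<rfloor>) + frac (x * 2 ^ s)) / 2 ^ s"
    by (simp add: frac_def)
  have "\<lfloor>x * 2 ^ s\<rfloor> < 2 ^ s" using \<open>x * 2 ^ s < 1 * 2 ^ s\<close> by (simp add: floor_less_iff)
  then show "nat \<lfloor>x * 2 ^ s\<rfloor> < 2 ^ s" using \<open>0 \<le> x * 2 ^ s\<close> by (simp add: nat_less_iff)
qed

lemma dyadic_add_unit_interval:
  assumes "0 \<le> x" "x < 1" "T < 2 ^ s"
  shows "dyadic_add x (real T / 2 ^ s) = (real (nat \<lfloor>x * 2 ^ s\<rfloor> XOR T) + frac (x * 2 ^ s)) / 2 ^ s"
  using dyadic_add_xor[OF _ _ unit_interval_split(2)[OF assms(1,2)] assms(3), of "frac (x * 2 ^ s)"]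
  unfolding unit_interval_split(1)[OF assms(1,2), symmetric] by (simp add: frac_lt_1)

lemma dyadic_add_nonneg:
  assumes "0 \<le> x" "x < 1" "T < 2 ^ s"
  shows "0 \<le> dyadic_add x (real T / 2 ^ s)"
  by (simp add: dyadic_add_unit_interval[OF assms])

lemma nat_add_unit_interval_eq_iff:
  fixes f g :: real
  assumes "0 \<le> f" "f < 1" "0 \<le> g" "g < 1"
  shows "real a + f = real b + g \<longleftrightarrow> a = b \<and> f = g"
proof
  assume *: "real a + f = real b + g"
  then have "real a < real b + 1" "real b < real a + 1" using assms by linarith+
  then have "a = b" by linarith
  then show "a = b \<and> f = g" using * by simp
qed simp

lemma nat_add_unit_interval_less_iff:
  fixes f g :: real
  assumes "0 \<le> f" "f < 1" "0 \<le> g" "g < 1"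
  shows "real a + f < real b + g \<longleftrightarrow> a < b \<or> (a = b \<and> f < g)"
  using assms by (cases a b rule: linorder_cases) auto

lemma xor_right_cancel: "a XOR T = b XOR T \<longleftrightarrow> a = (b::nat)"
  by (metis xor.assoc xor.right_neutral xor_self_eq)

lemma dyadic_add_cancel:
  assumes "0 \<le> x" "x < 1" "0 \<le> y" "y < 1" "T < 2 ^ s"
    and eq: "dyadic_add x (real T / 2 ^ s) = dyadic_add y (real T / 2 ^ s)"
  shows "x = y"
proof -
  have "nat \<lfloor>x * 2 ^ s\<rfloor> = nat \<lfloor>y * 2 ^ s\<rfloor> \<and> frac (x * 2 ^ s) = frac (y * 2 ^ s)"
    using eq assms by (simp add: dyadic_add_unit_interval nat_add_unit_interval_eq_iff frac_lt_1 xor_right_cancel)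
  then show ?thesis
    using unit_interval_split(1)[of x s] unit_interval_split(1)[of y s] assms by metis
qed

lemma sum_atMost_rademacher:
  assumes "v < 2 ^ s"
  shows "(\<Sum>a\<le>s. h a * rademacher s a v) = h 0 + (\<Sum>a=1..s. h a * rademacher s a v)"
proof -
  have "{..s} = insert 0 {1..s}" by auto
  then show ?thesis by (simp add: rademacher_0[OF assms])
qed

text \<open>For the shift \<open>w XOR v\<close>, the first \<open>s\<close> digits of the shifted
  point form \<open>e XOR v\<close>, where \<open>e = k XOR w\<close> does not depend on
  \<open>v\<close>. Thus \<open>of_bool_xor_less\<close> applies with fixed \<open>e\<close>. For
  \<open>e = 0\<close> the first \<open>s\<close> digits tie and the fractional parts decide, which
  contributes only to the constant term.\<close>

lemma indicator_expansion:
  assumes "0 \<le> x" "x < 1" "w < 2 ^ s" "v < 2 ^ s" "0 \<le> r" "r < 1 / 2 ^ s"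
  shows "of_bool (dyadic_add x (real (w XOR v) / 2 ^ s) < real v / 2 ^ s + r)
    = (\<Sum>a\<le>s. indicator_coeff s w r x a * rademacher s a v)"
proof -
  define k f where "k = nat \<lfloor>x * 2 ^ s\<rfloor>" and "f = frac (x * 2 ^ s)"
  define e where "e = k XOR w"
  have e: "e < 2 ^ s"
    unfolding e_def k_def by (intro xor_less_power unit_interval_split assms)
  have r: "r * 2 ^ s < 1" using assms by (simp add: pos_less_divide_eq)
  have "dyadic_add x (real (w XOR v) / 2 ^ s) = (real (e XOR v) + f) / 2 ^ s"
    using assms by (simp add: dyadic_add_unit_interval xor_less_power e_def k_def f_def xor.assoc)
  then have "dyadic_add x (real (w XOR v) / 2 ^ s) < real v / 2 ^ s + r
      \<longleftrightarrow> real (e XOR v) + f < real v + r * 2 ^ s"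
    by (simp add: pos_divide_less_eq distrib_right)
  also have "\<dots> \<longleftrightarrow> e XOR v < v \<or> (e XOR v = v \<and> f < r * 2 ^ s)"
    using assms r by (intro nat_add_unit_interval_less_iff) (auto simp: f_def frac_lt_1)
  also have "e XOR v = v \<longleftrightarrow> e = 0"
    using xor_right_cancel[of e v 0] by simp
  finally have "(of_bool (dyadic_add x (real (w XOR v) / 2 ^ s) < real v / 2 ^ s + r) :: real)
      = of_bool (e XOR v < v) + of_bool (e = 0 \<and> f < r * 2 ^ s)"
    by auto
  also have "\<dots> = (\<Sum>a=1..s. of_bool (e div 2 ^ (s - a) = 1) * (1 - rademacher s a v)) / 2
      + of_bool (e = 0 \<and> f < r * 2 ^ s)"
    by (simp only: of_bool_xor_less[OF e])
  also have "\<dots> = indicator_coeff s w r x 0 + (\<Sum>a=1..s. indicator_coeff s w r x a * rademacher s a v)"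
    unfolding indicator_coeff_def Let_def k_def[symmetric] e_def[symmetric] f_def[symmetric]
    by (simp del: sum_of_bool_mult_eq sum_mult_of_bool_eq sum_of_bool_eq add: right_diff_distrib sum_subtractf sum_negf diff_divide_distrib sum_divide_distrib)
  also have "\<dots> = (\<Sum>a\<le>s. indicator_coeff s w r x a * rademacher s a v)"
    by (rule sum_atMost_rademacher[OF assms(4), symmetric])
  finally show ?thesis .
qed

lemma coordinate_expansion:
  assumes "v < 2 ^ s"
  shows "real v / 2 ^ s + r = (\<Sum>a\<le>s. coordinate_coeff s r a * rademacher s a v)"
proof -
  have "real v / 2 ^ s = (\<Sum>a=1..s. 2 ^ (s - a) * (1 - rademacher s a v) / 2 ^ s) / 2"
    unfolding sum_divide_distrib[symmetric] by (subst rademacher_binary_expansion[OF assms]) simp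
  also have "(\<Sum>a=1..s. 2 ^ (s - a) * (1 - rademacher s a v) / 2 ^ s) = (\<Sum>a=1..s. (1 - rademacher s a v) / 2 ^ a)"
    by (intro sum.cong refl) (simp add: power_diff)
  finally have "real v / 2 ^ s + r = coordinate_coeff s r 0 + (\<Sum>a=1..s. coordinate_coeff s r a * rademacher s a v)"
    by (simp add: coordinate_coeff_def sum_subtractf sum_negf diff_divide_distrib sum_divide_distrib)
  then show ?thesis using sum_atMost_rademacher[OF assms] by simp
qed

section \<open>Expansion of the local discrepancy in all coordinates\<close>

definition discrepancy_coeff :: "nat \<Rightarrow> (real ^ 'n) set \<Rightarrow> ('n \<Rightarrow> nat) \<Rightarrow> real ^ 'n \<Rightarrow> ('n \<Rightarrow> nat) \<Rightarrow> real" where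
  "discrepancy_coeff s D W R g = (\<Sum>X\<in>D. \<Prod>i\<in>UNIV. indicator_coeff s (W i) (R $ i) (X $ i) (g i))
     - real (card D) * (\<Prod>i\<in>UNIV. coordinate_coeff s (R $ i) (g i))"

text \<open>Ensures that a shift preserves the number of points, and that counting shifted points in
  a box is a sum over \<open>D\<close>.\<close>

lemma inj_on_dyadic_add_vec:
  assumes "D \<subseteq> unit_cube" "T \<in> grid_indices s"
  shows "inj_on (\<lambda>X. dyadic_add_vec X (grid_point s T)) D"
proof (rule inj_onI)
  fix X Y assume XY: "X \<in> D" "Y \<in> D"
    and eq: "dyadic_add_vec X (grid_point s T) = dyadic_add_vec Y (grid_point s T)"
  show "X = Y"
    unfolding vec_eq_iff
  proof
    fix i
    have "dyadic_add (X $ i) (real (T i) / 2 ^ s) = dyadic_add (Y $ i) (real (T i) / 2 ^ s)"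
      using arg_cong[OF eq, of "\<lambda>Z. Z $ i"] by (simp add: dyadic_add_vec_def grid_point_def)
    moreover have "0 \<le> X $ i" "X $ i < 1" "0 \<le> Y $ i" "Y $ i < 1" "T i < 2 ^ s"
      using XY assms by (auto simp: unit_cube_def grid_indices_iff)
    ultimately show "X $ i = Y $ i" by (rule dyadic_add_cancel[rotated 5])
  qed
qed

text \<open>The indicator of a box and its volume are both products over the coordinates of
  Rademacher sums in \<open>V i\<close>. Distributivity turns each product into a sum over
  multi-indices \<open>g\<close>, and the coefficients are collected.\<close>

lemma local_discrepancy_chaos:
  fixes D :: "(real ^ 'n) set"
  assumes D: "D \<subseteq> unit_cube" "finite D" and W: "W \<in> grid_indices s" and V: "V \<in> grid_indices s"
    and R: "R \<in> grid_cell s"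
  shows "local_discrepancy (dyadic_shift D (grid_point s (\<lambda>i. W i XOR V i))) (grid_point s V + R)
    = (\<Sum>g\<in>PiE UNIV (\<lambda>_. {..s}). discrepancy_coeff s D W R g * (\<Prod>i\<in>UNIV. rademacher s (g i) (V i)))"
proof -
  define T where "T = (\<lambda>i. W i XOR V i)"
  define Y where "Y = grid_point s V + R"
  have lt: "W i < 2 ^ s" "V i < 2 ^ s" "T i < 2 ^ s" for i
    using W V by (auto simp: T_def grid_indices_iff intro: xor_less_power)
  then have T: "T \<in> grid_indices s" by (simp add: grid_indices_iff)
  have inj: "inj_on (\<lambda>X. dyadic_add_vec X (grid_point s T)) D"
    by (rule inj_on_dyadic_add_vec[OF D(1) T])
  have in_box: "of_bool (dyadic_add_vec X (grid_point s T) \<in> corner_box Y)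
      = (\<Prod>i\<in>UNIV. \<Sum>a\<le>s. indicator_coeff s (W i) (R $ i) (X $ i) a * rademacher s a (V i))" if "X \<in> D" for X
  proof -
    have X: "0 \<le> X $ i" "X $ i < 1" for i using that D by (auto simp: unit_cube_def)
    have "dyadic_add_vec X (grid_point s T) \<in> corner_box Y
        \<longleftrightarrow> (\<forall>i. dyadic_add (X $ i) (real (W i XOR V i) / 2 ^ s) < real (V i) / 2 ^ s + R $ i)"
      using dyadic_add_nonneg[OF X lt(3)]
      by (simp add: corner_box_def Y_def dyadic_add_vec_def grid_point_def T_def)
    also have "of_bool \<dots> = (\<Prod>i\<in>UNIV. of_bool (dyadic_add (X $ i) (real (W i XOR V i) / 2 ^ s) < real (V i) / 2 ^ s + R $ i) :: real)"
      by (auto simp: prod_zero_iff)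
    also have "\<dots> = (\<Prod>i\<in>UNIV. \<Sum>a\<le>s. indicator_coeff s (W i) (R $ i) (X $ i) a * rademacher s a (V i))"
      using R X lt by (intro prod.cong refl indicator_expansion) (auto simp: grid_cell_def)
    finally show ?thesis .
  qed
  have expand: "(\<Prod>i\<in>UNIV. \<Sum>a\<le>s. h i a * rademacher s a (V i))
      = (\<Sum>g\<in>PiE UNIV (\<lambda>_. {..s}). (\<Prod>i\<in>UNIV. h i (g i)) * (\<Prod>i\<in>UNIV. rademacher s (g i) (V i)))"
    for h :: "'n \<Rightarrow> nat \<Rightarrow> real"
    by (subst prod_sum_PiE) (auto simp: prod.distrib)
  have "dyadic_shift D (grid_point s T) \<inter> corner_box Y
      = (\<lambda>X. dyadic_add_vec X (grid_point s T)) ` {X \<in> D. dyadic_add_vec X (grid_point s T) \<in> corner_box Y}"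
    by (auto simp: dyadic_shift_def)
  then have "card (dyadic_shift D (grid_point s T) \<inter> corner_box Y)
      = card {X \<in> D. dyadic_add_vec X (grid_point s T) \<in> corner_box Y}"
    using card_image[OF inj_on_subset[OF inj]] by auto
  then have count: "real (card (dyadic_shift D (grid_point s T) \<inter> corner_box Y))
      = (\<Sum>X\<in>D. of_bool (dyadic_add_vec X (grid_point s T) \<in> corner_box Y))"
    using D(2) by (simp add: of_bool_def sum.If_cases Int_def)
  have "card (dyadic_shift D (grid_point s T)) = card D"
    unfolding dyadic_shift_def by (rule card_image[OF inj])
  moreover have "(\<Prod>i\<in>UNIV. Y $ i) = (\<Prod>i\<in>UNIV. \<Sum>a\<le>s. coordinate_coeff s (R $ i) a * rademacher s a (V i))"
    using lt by (intro prod.cong refl) (simp add: Y_def grid_point_def coordinate_expansion)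
  ultimately have "local_discrepancy (dyadic_shift D (grid_point s T)) Y
      = (\<Sum>X\<in>D. \<Prod>i\<in>UNIV. \<Sum>a\<le>s. indicator_coeff s (W i) (R $ i) (X $ i) a * rademacher s a (V i))
      - real (card D) * (\<Prod>i\<in>UNIV. \<Sum>a\<le>s. coordinate_coeff s (R $ i) a * rademacher s a (V i))"
    unfolding local_discrepancy_def count using in_box by simp
  also have "\<dots> = (\<Sum>g\<in>PiE UNIV (\<lambda>_. {..s}). discrepancy_coeff s D W R g * (\<Prod>i\<in>UNIV. rademacher s (g i) (V i)))"
    unfolding expand discrepancy_coeff_def left_diff_distrib sum_subtractf sum_distrib_right sum_distrib_left mult.assoc
    by (subst sum.swap) (rule refl)
  finally show ?thesis by (simp add: T_def Y_def)
qed

text \<open>Up to the factor \<open>(-1/2)^d\<close>, the coefficient is an integer minus \<open>card D / 2 ^ n\<close>.\<close>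

lemma discrepancy_coeff_square_ge:
  fixes D :: "(real ^ 'n) set"
  assumes g: "\<And>i. 1 \<le> g i" "\<And>i. g i \<le> s" "(\<Sum>i\<in>UNIV. g i) = n"
    and c: "c \<le> real (card D) / 2 ^ n" "real (card D) / 2 ^ n \<le> 1 - c" "0 \<le> c"
  shows "(c / 2 ^ CARD('n))\<^sup>2 \<le> (discrepancy_coeff s D W R g)\<^sup>2"
proof -
  \<comment> \<open>For points of the cube and \<open>W\<close> in \<open>grid_indices s\<close>,
    this describes a dyadic box with sides \<open>1 / 2 ^ g i\<close>, hence of volume
    \<open>1 / 2 ^ n\<close>. So \<open>j\<close> counts the points of \<open>D\<close> in it, and
    the coefficient is a multiple of the discrepancy of that box.\<close>
  define P where "P = (\<lambda>X :: real ^ 'n. \<forall>i. (nat \<lfloor>X $ i * 2 ^ s\<rfloor> XOR W i) div 2 ^ (s - g i) = 1)"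
  define j where "j = (\<Sum>X\<in>D. of_bool (P X) :: nat)"
  have "indicator_coeff s (W i) (R $ i) (X $ i) (g i)
      = (- 1 / 2) * of_bool ((nat \<lfloor>X $ i * 2 ^ s\<rfloor> XOR W i) div 2 ^ (s - g i) = 1)" for X :: "real ^ 'n" and i
    using g(1)[of i] by (simp add: indicator_coeff_def Let_def)
  then have "(\<Prod>i\<in>UNIV. indicator_coeff s (W i) (R $ i) (X $ i) (g i))
      = (- 1 / 2) ^ CARD('n) * (\<Prod>i\<in>UNIV. of_bool ((nat \<lfloor>X $ i * 2 ^ s\<rfloor> XOR W i) div 2 ^ (s - g i) = 1))"
    for X :: "real ^ 'n"
    by (simp only: prod.distrib prod_constant)
  moreover have "(\<Prod>i\<in>UNIV. of_bool ((nat \<lfloor>X $ i * 2 ^ s\<rfloor> XOR W i) div 2 ^ (s - g i) = 1) :: real) = of_bool (P X)"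
    for X :: "real ^ 'n"
    unfolding P_def by (auto simp: prod_zero_iff)
  moreover have "(\<Prod>i\<in>UNIV. coordinate_coeff s (R $ i) (g i)) = (- 1 / 2) ^ CARD('n) * (1 / 2 ^ n)"
  proof -
    have "coordinate_coeff s (R $ i) (g i) = (- 1 / 2) * (1 / 2 ^ g i)" for i
      using g(1)[of i] by (simp add: coordinate_coeff_def)
    then have "(\<Prod>i\<in>UNIV. coordinate_coeff s (R $ i) (g i)) = (- 1 / 2) ^ CARD('n) * (\<Prod>i\<in>UNIV. 1 / 2 ^ g i)"
      by (simp only: prod.distrib prod_constant)
    then show ?thesis by (simp add: prod_dividef power_sum[symmetric] g(3))
  qed
  ultimately have "discrepancy_coeff s D W R g = (- 1 / 2) ^ CARD('n) * (real j - real (card D) / 2 ^ n)"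
    by (simp add: discrepancy_coeff_def j_def sum_distrib_left right_diff_distrib)
  then have "\<bar>discrepancy_coeff s D W R g\<bar> = \<bar>real j - real (card D) / 2 ^ n\<bar> / 2 ^ CARD('n)"
    by (simp add: abs_mult power_abs power_divide)
  \<comment> \<open>The integer \<open>j\<close> is either 0 or at least 1, and
    \<open>card D / 2 ^ n\<close> keeps distance \<open>c\<close> from both sides.\<close>
  moreover have "c \<le> \<bar>real j - real (card D) / 2 ^ n\<bar>"
  proof (cases "j = 0")
    case False
    then have "1 \<le> real j" by simp
    then show ?thesis using c by linarith
  qed (use c in auto)
  ultimately have "\<bar>c / 2 ^ CARD('n)\<bar> \<le> \<bar>discrepancy_coeff s D W R g\<bar>"
    using c by (simp add: divide_right_mono)
  then show ?thesis by (simp only: abs_le_square_iff)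
qed

text \<open>All parts except the one at \<open>i0\<close> are chosen freely from
  \<open>{1..p}\<close>, and the part at \<open>i0\<close> completes the sum. The free parts add up
  to between \<open>k\<close> and \<open>k * p\<close>, so the last lies between 1 and
  \<open>k * (p - 1) + 1\<close>; the extra 1 in the total keeps it positive.\<close>

lemma exists_many_compositions:
  fixes p s k :: nat
  assumes k: "CARD('n::finite) = Suc k" and p: "1 \<le> p" "p \<le> s" "k * (p - 1) + 1 \<le> s"
  shows "\<exists>A :: ('n \<Rightarrow> nat) set. card A = p ^ k \<and> finite A \<and>
    (\<forall>g\<in>A. (\<forall>i. 1 \<le> g i \<and> g i \<le> s) \<and> (\<Sum>i\<in>UNIV. g i) = k * p + 1)"
proof -
  fix i0 :: 'n
  define J where "J = UNIV - {i0}"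
  have J: "i0 \<notin> J" "finite J" "card J = k" "UNIV = insert i0 J"
    using k by (auto simp: J_def)
  define E where "E = (\<lambda>(h :: 'n \<Rightarrow> nat) i. if i = i0 then k * p + 1 - (\<Sum>j\<in>J. h j) else h i)"
  define A where "A = E ` PiE J (\<lambda>_. {1..p})"
  have "inj_on E (PiE J (\<lambda>_. {1..p}))"
  proof (rule inj_onI)
    fix h h' assume hh: "h \<in> PiE J (\<lambda>_. {1..p})" "h' \<in> PiE J (\<lambda>_. {1..p})" and eq: "E h = E h'"
    show "h = h'"
    proof (rule PiE_ext[OF hh])
      fix i assume "i \<in> J"
      then show "h i = h' i" using fun_cong[OF eq, of i] J(1) by (auto simp: E_def split: if_splits)
    qed
  qed
  then have "card A = p ^ k"
    using J by (simp add: A_def card_image card_PiE)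
  moreover have "(\<forall>i. 1 \<le> E h i \<and> E h i \<le> s) \<and> (\<Sum>i\<in>UNIV. E h i) = k * p + 1"
    if h: "h \<in> PiE J (\<lambda>_. {1..p})" for h
  proof -
    have hj: "1 \<le> h j" "h j \<le> p" if "j \<in> J" for j using h that by (auto simp: PiE_iff)
    have "(\<Sum>j\<in>J. h j) \<le> (\<Sum>j\<in>J. p)" "(\<Sum>j\<in>J. 1) \<le> (\<Sum>j\<in>J. h j)"
      by (rule sum_mono, erule hj)+
    then have S: "(\<Sum>j\<in>J. h j) \<le> k * p" "k \<le> (\<Sum>j\<in>J. h j)" using J by auto
    have "k * (p - 1) = k * p - k" by (simp add: right_diff_distrib')
    then have "1 \<le> E h i0" "E h i0 \<le> s" using S p by (auto simp: E_def)
    moreover have "1 \<le> E h i \<and> E h i \<le> s" if "i \<noteq> i0" for i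
      using that hj[of i] p by (auto simp: E_def J_def)
    moreover have "(\<Sum>j\<in>J. E h j) = (\<Sum>j\<in>J. h j)"
      using J(1) by (intro sum.cong) (auto simp: E_def)
    then have "(\<Sum>i\<in>UNIV. E h i) = k * p + 1"
    proof -
      have "(\<Sum>i\<in>UNIV. E h i) = E h i0 + (\<Sum>j\<in>J. E h j)"
        using J(1,2) by (subst J(4)) simp
      then show ?thesis using \<open>(\<Sum>j\<in>J. E h j) = (\<Sum>j\<in>J. h j)\<close> S by (simp add: E_def)
    qed
    ultimately show ?thesis by metis
  qed
  moreover have "finite A" using J by (simp add: A_def finite_PiE)
  ultimately show ?thesis by (intro exI[of _ A]) (auto simp: A_def)
qed

subsection \<open>The lower bound\<close>

text \<open>The moment comparison for the chaos in \<open>V\<close>, with block constant 3 in each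
  of the coordinates. Its variance \<open>v\<close> is bounded below by keeping only the
  \<open>p ^ k\<close> coefficients supplied by \<open>exists_many_compositions\<close>, each of
  which is large.\<close>

lemma chaos_moment_ge:
  fixes D :: "(real ^ 'n) set" and s k p :: nat and q :: real
  assumes D: "D \<subseteq> unit_cube" "finite D" and q: "0 < q" "q \<le> 1"
    and k: "CARD('n) = Suc k" and p: "1 \<le> p" "p \<le> s" "k * (p - 1) + 1 \<le> s"
    and c: "0 < c" "c \<le> real (card D) / 2 ^ (k * p + 1)" "real (card D) / 2 ^ (k * p + 1) \<le> 1 - c"
    and W: "W \<in> grid_indices s" and R: "R \<in> grid_cell s"
  shows "2 ^ (CARD('n) * s) * (((real p ^ k * (c / 2 ^ CARD('n))\<^sup>2) * 3 ^ CARD('n)) powr (q / 2) / 3 ^ CARD('n))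
    \<le> (\<Sum>V\<in>grid_indices s. \<bar>local_discrepancy (dyadic_shift D (grid_point s (\<lambda>i. W i XOR V i))) (grid_point s V + R)\<bar> powr q)"
proof -
  let ?G = "PiE (UNIV :: 'n set) (\<lambda>_. {..s})"
  define F where "F = (\<lambda>V. \<Sum>g\<in>?G. discrepancy_coeff s D W R g * (\<Prod>i\<in>UNIV. rademacher s (g i) (V i)))"
  define v where "v = (\<Sum>g\<in>?G. (discrepancy_coeff s D W R g)\<^sup>2)"
  obtain A :: "('n \<Rightarrow> nat) set" where A: "card A = p ^ k" "finite A"
      "\<And>g i. g \<in> A \<Longrightarrow> 1 \<le> g i \<and> g i \<le> s" "\<And>g. g \<in> A \<Longrightarrow> (\<Sum>i\<in>UNIV. g i) = k * p + 1"
    using exists_many_compositions[OF k p] by metis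
  have "real p ^ k * (c / 2 ^ CARD('n))\<^sup>2 = (\<Sum>g\<in>A. (c / 2 ^ CARD('n))\<^sup>2)"
    using A(1) by simp
  also have "\<dots> \<le> (\<Sum>g\<in>A. (discrepancy_coeff s D W R g)\<^sup>2)"
    using A c by (intro sum_mono discrepancy_coeff_square_ge[of _ _ "k * p + 1"]) auto
  also have "\<dots> \<le> v"
    unfolding v_def using A by (intro sum_mono2) (auto simp: finite_PiE)
  finally have v: "real p ^ k * (c / 2 ^ CARD('n))\<^sup>2 \<le> v" .
  have pos: "0 < real p ^ k * (c / 2 ^ CARD('n))\<^sup>2" using p c by simp
  have M: "(2 ^ s) ^ card (UNIV :: 'n set) = (2 :: real) ^ (CARD('n) * s)"
    by (simp add: power_mult[symmetric] mult.commute)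
  have "(\<Sum>V\<in>grid_indices s. (F V)\<^sup>2) = 2 ^ (CARD('n) * s) * v"
    unfolding F_def v_def grid_indices_def M[symmetric]
    by (rule tensor_moments(1)[where C = 3])
       (simp_all add: rademacher_second_moment rademacher_fourth_moment)
  moreover have "(\<Sum>V\<in>grid_indices s. F V ^ 4) \<le> 2 ^ (CARD('n) * s) * 3 ^ CARD('n) * v\<^sup>2"
    unfolding F_def v_def grid_indices_def M[symmetric] power_mult_distrib[symmetric]
    by (rule tensor_moments(2))
       (simp_all add: rademacher_second_moment rademacher_fourth_moment)
  ultimately have "2 ^ (CARD('n) * s) * ((v * 3 ^ CARD('n)) powr (q / 2) / 3 ^ CARD('n))
      \<le> (\<Sum>V\<in>grid_indices s. \<bar>F V\<bar> powr q)"
    using v pos q by (intro powr_moment_ge) auto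
  moreover have "((real p ^ k * (c / 2 ^ CARD('n))\<^sup>2) * 3 ^ CARD('n)) powr (q / 2) \<le> (v * 3 ^ CARD('n)) powr (q / 2)"
    using v pos q by (intro powr_mono2 mult_right_mono) auto
  then have "2 ^ (CARD('n) * s) * (((real p ^ k * (c / 2 ^ CARD('n))\<^sup>2) * 3 ^ CARD('n)) powr (q / 2) / 3 ^ CARD('n))
      \<le> 2 ^ (CARD('n) * s) * ((v * 3 ^ CARD('n)) powr (q / 2) / 3 ^ CARD('n))"
    by (intro mult_left_mono divide_right_mono) auto
  moreover have "F V = local_discrepancy (dyadic_shift D (grid_point s (\<lambda>i. W i XOR V i))) (grid_point s V + R)"
    if "V \<in> grid_indices s" for V
    unfolding F_def by (rule local_discrepancy_chaos[OF D W that R, symmetric])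
  ultimately show ?thesis by simp
qed

section \<open>Measurability and integrability of the local discrepancy\<close>

lemma borel_corner_box_section: "{Y :: real ^ 'n. X \<in> corner_box Y} \<in> sets borel"
proof -
  have "{Y. X \<in> corner_box Y} = (\<Inter>i. {Y :: real ^ 'n. 0 \<le> X $ i \<and> X $ i < Y $ i})"
    by (auto simp: corner_box_def)
  also have "\<dots> \<in> sets borel" by measurable
  finally show ?thesis .
qed

lemma borel_measurable_local_discrepancy [measurable]:
  assumes "finite D"
  shows "local_discrepancy D \<in> borel_measurable borel"
proof -
  have "local_discrepancy D = (\<lambda>Y. (\<Sum>X\<in>D. indicator {Y. X \<in> corner_box Y} Y) - real (card D) * (\<Prod>i\<in>UNIV. Y $ i))"
    using assms by (auto simp: local_discrepancy_def fun_eq_iff indicator_def sum.If_cases Int_def)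
  also have "\<dots> \<in> borel_measurable borel"
    using borel_corner_box_section by measurable
  finally show ?thesis .
qed

lemma abs_local_discrepancy_le:
  assumes "finite D" "Y \<in> unit_cube"
  shows "\<bar>local_discrepancy D Y\<bar> \<le> real (card D)"
proof -
  have "card (D \<inter> corner_box Y) \<le> card D" using assms by (intro card_mono) auto
  moreover have "0 \<le> (\<Prod>i\<in>UNIV. Y $ i)" "(\<Prod>i\<in>UNIV. Y $ i) \<le> 1"
    using assms by (auto simp: unit_cube_def less_imp_le intro!: prod_nonneg prod_le_1)
  then have "0 \<le> real (card D) * (\<Prod>i\<in>UNIV. Y $ i)" "real (card D) * (\<Prod>i\<in>UNIV. Y $ i) \<le> real (card D)"
    by (auto intro: mult_left_le)
  ultimately show ?thesis by (auto simp: local_discrepancy_def abs_le_iff)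
qed

lemma set_integrable_local_discrepancy:
  fixes D :: "(real ^ 'n) set"
  assumes "finite D" "0 < q"
  shows "set_integrable lborel unit_cube (\<lambda>Y. \<bar>local_discrepancy D Y\<bar> powr q)"
  unfolding set_integrable_def
proof (rule Bochner_Integration.integrable_bound)
  show "integrable lborel (\<lambda>Y :: real ^ 'n. indicator unit_cube Y *\<^sub>R (real (card D) powr q))"
    using set_integrable_const_unit_cube[of "real (card D) powr q"] by (simp add: set_integrable_def)
  show "AE Y in lborel. norm (indicator unit_cube Y *\<^sub>R \<bar>local_discrepancy D Y\<bar> powr q)
      \<le> norm (indicator unit_cube Y *\<^sub>R (real (card D) powr q))"
    using assms by (intro always_eventually) (auto simp: indicator_def intro!: powr_mono2 abs_local_discrepancy_le)
qed (use assms in measurable)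

lemma Lq_discrepancy_powr:
  assumes "0 < q"
  shows "Lq_discrepancy q D powr q = (LINT Y:unit_cube|lborel. \<bar>local_discrepancy D Y\<bar> powr q)"
proof -
  have "0 \<le> (LINT Y:unit_cube|lborel. \<bar>local_discrepancy D Y\<bar> powr q)"
    unfolding set_lebesgue_integral_def by (intro Bochner_Integration.integral_nonneg) auto
  then show ?thesis using assms by (simp add: Lq_discrepancy_def powr_powr)
qed

text \<open>
  The chaos estimate needs \<open>V\<close> to vary while \<open>W\<close> is fixed, hence the sum over shifts \<open>T\<close> is
  reparametrized by \<open>T = W XOR V\<close>.
\<close>

lemma mean_discrepancy_powr_ge:
  fixes D :: "(real ^ 'n) set" and s k p :: nat and q c :: real
  defines "B \<equiv> ((real p ^ k * (c / 2 ^ CARD('n))\<^sup>2) * 3 ^ CARD('n)) powr (q / 2) / 3 ^ CARD('n)"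
  assumes D: "D \<subseteq> unit_cube" "finite D" and q: "0 < q" "q \<le> 1"
    and k: "CARD('n) = Suc k" and p: "1 \<le> p" "p \<le> s" "k * (p - 1) + 1 \<le> s"
    and c: "0 < c" "c \<le> real (card D) / 2 ^ (k * p + 1)" "real (card D) / 2 ^ (k * p + 1) \<le> 1 - c"
  shows "2 ^ (CARD('n) * s) * B \<le> (\<Sum>T\<in>dyadic_vectors s. Lq_discrepancy q (dyadic_shift D T) powr q)"
proof -
  let ?I = "grid_indices s :: ('n \<Rightarrow> nat) set"
  define L where "L = (\<lambda>T Y. \<bar>local_discrepancy (dyadic_shift D (grid_point s T)) Y\<bar> powr q)"
  have fin: "finite (dyadic_shift D T)" for T using D by (simp add: dyadic_shift_def)
  have int: "set_integrable lborel unit_cube (L T)" for T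
    unfolding L_def by (rule set_integrable_local_discrepancy[OF fin q(1)])
  have [measurable]: "L T \<in> borel_measurable borel" for T
    unfolding L_def using borel_measurable_local_discrepancy[OF fin] by measurable
  \<comment> \<open>XOR with a fixed \<open>V\<close> is an involution of the index set.\<close>
  have shift: "(\<Sum>T\<in>?I. L T Y) = (\<Sum>W\<in>?I. L (\<lambda>i. W i XOR V i) Y)" if "V \<in> ?I" for V Y
  proof (rule sum.reindex_bij_witness[of _ "\<lambda>W i. W i XOR V i" "\<lambda>T i. T i XOR V i"])
    show "(\<lambda>i. T i XOR V i) \<in> ?I" if "T \<in> ?I" for T
      using that \<open>V \<in> ?I\<close> by (auto simp: grid_indices_iff xor_less_power)
    then show "(\<lambda>i. T i XOR V i) \<in> ?I" if "T \<in> ?I" for T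
      using that by blast
  qed (simp_all add: xor.assoc)
  have "2 ^ (CARD('n) * s) * B \<le> (LINT Y:unit_cube|lborel. (\<Sum>T\<in>?I. L T Y))"
  proof (rule unit_cube_integral_ge)
    show "set_integrable lborel unit_cube (\<lambda>Y. \<Sum>T\<in>?I. L T Y)"
      using int unfolding set_integrable_def scaleR_sum_right by (intro Bochner_Integration.integrable_sum) auto
    fix R :: "real ^ 'n" assume R: "R \<in> grid_cell s"
    \<comment> \<open>The outer power of two is the number of choices of \<open>W\<close>, each
      contributing one chaos estimate.\<close>
    have "2 ^ (CARD('n) * s) * (2 ^ (CARD('n) * s) * B) = (\<Sum>W\<in>?I. 2 ^ (CARD('n) * s) * B)"
      by (simp add: card_grid_indices)
    also have "\<dots> \<le> (\<Sum>W\<in>?I. \<Sum>V\<in>?I. L (\<lambda>i. W i XOR V i) (grid_point s V + R))"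
      unfolding B_def L_def by (intro sum_mono chaos_moment_ge[OF D q k p c _ R])
    also have "\<dots> = (\<Sum>V\<in>?I. \<Sum>T\<in>?I. L T (grid_point s V + R))"
      by (subst sum.swap) (simp add: shift)
    finally show "2 ^ (CARD('n) * s) * (2 ^ (CARD('n) * s) * B) \<le> (\<Sum>V\<in>?I. \<Sum>T\<in>?I. L T (grid_point s V + R))" .
  qed simp
  also have "\<dots> = (\<Sum>T\<in>?I. (LINT Y:unit_cube|lborel. L T Y))"
    using int unfolding set_integrable_def set_lebesgue_integral_def scaleR_sum_right
    by (intro Bochner_Integration.integral_sum) auto
  also have "\<dots> = (\<Sum>T\<in>?I. Lq_discrepancy q (dyadic_shift D (grid_point s T)) powr q)"
    by (simp add: Lq_discrepancy_powr[OF q(1)] L_def)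
  also have "\<dots> = (\<Sum>T\<in>dyadic_vectors s. Lq_discrepancy q (dyadic_shift D T) powr q)"
    by (rule sum.reindex_bij_betw[OF bij_betw_grid_point])
  finally show ?thesis .
qed

text \<open>The factor \<open>k powr (- k / 2)\<close> in \<open>gamma_const\<close> turns
  \<open>L powr (k / 2)\<close> into a power of \<open>L / k\<close>, which is below
  \<open>p\<close>. On the right, \<open>3 / 16\<close> is split as \<open>3 / 4\<close> times
  \<open>1 / 4\<close>: the second factor gives \<open>2 powr (- d * q)\<close>, while
  \<open>(3 / 4) powr (d * q / 2)\<close> is at least \<open>(3 / 4) ^ d\<close>, which divided by
  \<open>3 ^ d\<close> is \<open>1 / 4 ^ d\<close>. A spare factor \<open>2 powr (- 1 - q)\<close>
  on the left makes the inequality strict.\<close>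

lemma gamma_const_powr_less:
  fixes L q :: real and p k d :: nat
  assumes "d = Suc k" "1 \<le> k" "0 < q" "q \<le> 1" "0 \<le> L" "L < real p * real k"
  shows "(gamma_const q d * L powr (1 / 2 * (real d - 1))) powr q
    < ((real p ^ k * ((1 / 2 ^ d) / 2 ^ d)\<^sup>2) * 3 ^ d) powr (q / 2) / 3 ^ d"
proof -
  define P where "P = real p powr (real k / 2)"
  have p: "0 < real p" using assms by (cases "p = 0") auto
  have P: "0 < P" using p by (simp add: P_def)
  have "L powr (real k / 2) * real k powr (- (real k / 2)) = (L / real k) powr (real k / 2)"
    using assms by (simp add: powr_divide powr_minus_divide)
  also have "\<dots> \<le> P"
    unfolding P_def using assms by (intro powr_mono2) (auto simp: divide_le_eq)
  finally have LP: "L powr (real k / 2) * real k powr (- (real k / 2)) \<le> P" .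
  have "gamma_const q d * L powr (1 / 2 * (real d - 1))
      = 2 powr (- (2 * real d + 1) / q - real d - 1) * (L powr (real k / 2) * real k powr (- (real k / 2)))"
    using assms by (simp add: gamma_const_def)
  also have "\<dots> \<le> 2 powr (- (2 * real d + 1) / q - real d - 1) * P"
    using LP by (intro mult_left_mono) auto
  finally have "(gamma_const q d * L powr (1 / 2 * (real d - 1))) powr q
      \<le> (2 powr (- (2 * real d + 1) / q - real d - 1) * P) powr q"
    using assms by (intro powr_mono2) (auto simp: gamma_const_def)
  also have "\<dots> = 2 powr ((- (2 * real d + 1) / q - real d - 1) * q) * P powr q"
    using P by (simp add: powr_mult powr_powr)
  also have "(- (2 * real d + 1) / q - real d - 1) * q = - (2 * real d + 1) - (real d + 1) * q"
    using assms by (simp add: field_simps)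
  also have "2 powr (- (2 * real d + 1) - (real d + 1) * q) * P powr q < 2 powr (- 2 * real d - real d * q) * P powr q"
  proof (intro mult_strict_right_mono powr_less_mono)
    show "- (2 * real d + 1) - (real d + 1) * q < - 2 * real d - real d * q"
      using assms by (simp add: algebra_simps)
  qed (use P in auto)
  also have "2 powr (- 2 * real d - real d * q) * P powr q
      \<le> (((real p ^ k * ((1 / 2 ^ d) / 2 ^ d)\<^sup>2) * 3 ^ d) powr (q / 2)) / 3 ^ d"
  proof -
    have "(real p ^ k * ((1 / 2 ^ d) / 2 ^ d)\<^sup>2) * 3 ^ d = real p ^ k * ((3 / 4) ^ d * (1 / 4) ^ d)"
    proof -
      have "((1 / 2 ^ d) / 2 ^ d :: real)\<^sup>2 * 3 ^ d = (3 / 16) ^ d"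
        by (simp add: power_divide power_mult_distrib[symmetric] power2_eq_square)
      moreover have "(3 / 4) ^ d * (1 / 4) ^ d = (3 / 16 :: real) ^ d"
        by (simp add: power_mult_distrib[symmetric])
      ultimately show ?thesis by simp
    qed
    also have "\<dots> powr (q / 2) = P powr q * ((3 / 4) powr (real d * q / 2) * (1 / 4) powr (real d * q / 2))"
      using p by (simp add: P_def powr_mult powr_powr powr_realpow[symmetric])
    also have "(1 / 4) powr (real d * q / 2) = 2 powr (- (real d * q))"
    proof -
      have "(1 / 4 :: real) = 2 powr (- 2)" by (simp add: powr_minus_divide)
      then show ?thesis by (simp only: powr_powr) simp
    qed
    finally have eq: "((real p ^ k * ((1 / 2 ^ d) / 2 ^ d)\<^sup>2) * 3 ^ d) powr (q / 2)
        = P powr q * ((3 / 4) powr (real d * q / 2) * 2 powr (- (real d * q)))" .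
    have "real d * q / 2 \<le> real d" using assms mult_left_mono[of q 2 "real d"] by simp
    then have "(3 / 4 :: real) powr real d \<le> (3 / 4) powr (real d * q / 2)"
      by (intro powr_mono') auto
    then have "(3 / 4) ^ d / 3 ^ d \<le> (3 / 4 :: real) powr (real d * q / 2) / 3 ^ d"
      by (intro divide_right_mono) (simp_all add: powr_realpow)
    moreover have "2 powr (- 2 * real d) = (3 / 4 :: real) ^ d / 3 ^ d"
    proof -
      have "2 powr (- 2 * real d) = (2 powr (- 2)) powr real d" by (simp only: powr_powr)
      also have "\<dots> = (1 / 4) ^ d" by (simp add: powr_minus_divide powr_realpow)
      finally show ?thesis by (simp add: power_divide)
    qed
    ultimately have le: "2 powr (- 2 * real d) \<le> (3 / 4 :: real) powr (real d * q / 2) / 3 ^ d" by simp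
    have "2 powr (- 2 * real d - real d * q) * P powr q = P powr q * 2 powr (- (real d * q)) * 2 powr (- 2 * real d)"
      by (simp add: powr_diff powr_minus_divide)
    also have "\<dots> \<le> P powr q * 2 powr (- (real d * q)) * ((3 / 4 :: real) powr (real d * q / 2) / 3 ^ d)"
      by (intro mult_left_mono le) simp
    finally show ?thesis unfolding eq by (simp add: ac_simps)
  qed
  finally show ?thesis .
qed

theorem theorem2p2:
  fixes D :: "(real ^ 'n) set" and d N s :: nat and q :: real
  assumes "CARD('n) = d" and "d \<ge> 2"
    and "D \<subseteq> unit_cube" and "finite D" and "card D = N" and "N \<ge> 1"
    and "0 < q" and "q \<le> 1"
    and "real s \<ge> log 2 (real N) + (2 * real d + 1) / q
            + 1 / 2 * (real d - 1) * log 2 (real d - 1) + real d + 1 + log 2 (real d)"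
  shows "mean_discrepancy s q D
           > gamma_const q d * log 2 (real N) powr (1 / 2 * (real d - 1))
       \<and> (\<exists>T\<in>dyadic_vectors s. Lq_discrepancy q (dyadic_shift D T)
           > gamma_const q d * log 2 (real N) powr (1 / 2 * (real d - 1)))"
proof -
  define k where "k = d - 1"
  define L where "L = log 2 (real N)"
  define p where "p = nat \<lfloor>L / real k\<rfloor> + 1"
    \<comment> \<open>keeps \<open>N / 2 ^ n\<close>, where \<open>n = k * p + 1\<close>, in the interval from \<open>1 / 2 ^ d\<close> to \<open>1 / 2\<close>\<close>
  define G where "G = gamma_const q d * L powr (1 / 2 * (real d - 1))"
  have k: "d = Suc k" "1 \<le> k" "CARD('n) = Suc k" using assms by (auto simp: k_def)
  have L: "0 \<le> L" "2 powr L = real N" using assms by (auto simp: L_def)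
  have G: "0 \<le> G" by (simp add: G_def gamma_const_def)
  have fl: "0 \<le> \<lfloor>L / real k\<rfloor>" using L by simp
  then have "real p = of_int \<lfloor>L / real k\<rfloor> + 1" by (simp add: p_def)
  then have "real p - 1 \<le> L / real k" "L / real k < real p" by linarith+
  then have p_bounds: "real k * (real p - 1) \<le> L" "L < real p * real k"
    using k by (simp_all add: field_simps)
  \<comment> \<open>Room for every part of the compositions: both \<open>p\<close> and
    \<open>k * (p - 1) + 1\<close> are at most \<open>L + 1\<close>.\<close>
  have s: "L + 1 \<le> real s"
  proof -
    have "0 \<le> 1 / 2 * (real d - 1) * log 2 (real d - 1)" "0 \<le> log 2 (real d)" "0 \<le> (2 * real d + 1) / q"
      using assms by auto
    then show ?thesis using assms(9) by (simp add: L_def)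
  qed
  have "1 * (real p - 1) \<le> real k * (real p - 1)"
    using k by (intro mult_right_mono) (auto simp: p_def)
  then have p: "1 \<le> p" "p \<le> s" using p_bounds s by (auto simp: p_def)
  have "real (k * (p - 1) + 1) \<le> real s"
    using p_bounds(1) p s by (simp add: of_nat_diff)
  then have p': "k * (p - 1) + 1 \<le> s" by (simp only: of_nat_le_iff)
  \<comment> \<open>Already \<open>2 ^ (k * p)\<close> is at least \<open>N\<close>; the additional
    1 in the exponent gains the factor \<open>1 / 2\<close>.\<close>
  have upper: "real N / 2 ^ (k * p + 1) \<le> 1 / 2"
  proof -
    have "real N \<le> 2 powr (real (k * p))"
      unfolding L(2)[symmetric] using p_bounds(2) by (intro powr_mono) (auto simp: mult.commute)
    then have "real N \<le> 2 ^ (k * p)" by (simp only: powr_realpow zero_less_numeral)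
    then show ?thesis by simp
  qed
  \<comment> \<open>The exponent is \<open>k * (p - 1) + k + 1\<close>, which is at most
    \<open>L + d\<close>.\<close>
  have lower: "1 / 2 ^ d \<le> real N / 2 ^ (k * p + 1)"
  proof -
    have "2 powr (real (k * p + 1)) \<le> 2 powr (L + real d)"
      using p_bounds(1) k by (intro powr_mono) (auto simp: algebra_simps)
    then have "2 ^ (k * p + 1) \<le> real N * 2 ^ d"
      by (simp only: powr_realpow powr_add L zero_less_numeral)
    then show ?thesis by (simp add: field_simps)
  qed
  \<comment> \<open>The lower end of the interval for \<open>N / 2 ^ n\<close>. It is at most
    \<open>1 / 2\<close>, so the upper end \<open>1 / 2\<close> also keeps distance \<open>c\<close>
    from 1.\<close>
  define c :: real where "c = 1 / 2 ^ d"
  have "(2::real) ^ 1 \<le> 2 ^ d" using assms(2) by (intro power_increasing) auto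
  then have "0 < c" "c \<le> 1 / 2" by (simp_all add: c_def)
  then have c: "0 < c" "c \<le> real (card D) / 2 ^ (k * p + 1)" "real (card D) / 2 ^ (k * p + 1) \<le> 1 - c"
    using upper lower unfolding assms(5) c_def[symmetric] by linarith+
  define S where "S = (\<Sum>T\<in>dyadic_vectors s. Lq_discrepancy q (dyadic_shift D T) powr q)"
  have "G powr q < (real p ^ k * (c / 2 ^ d)\<^sup>2 * 3 ^ d) powr (q / 2) / 3 ^ d"
    unfolding G_def c_def using k assms L p_bounds by (intro gamma_const_powr_less) auto
  then have "2 ^ (d * s) * G powr q < 2 ^ (d * s) * ((real p ^ k * (c / 2 ^ d)\<^sup>2 * 3 ^ d) powr (q / 2) / 3 ^ d)"
    by (rule mult_strict_left_mono) simp
  also have "\<dots> \<le> S"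
    using mean_discrepancy_powr_ge[OF assms(3,4,7,8) k(3) p p' c] by (simp add: S_def assms(1))
  finally have S: "2 ^ (d * s) * G powr q < S" .
  have inv: "2 powr (- real (d * s)) = 1 / 2 ^ (d * s)"
    by (simp add: powr_minus_divide powr_realpow del: of_nat_mult)
  have "G = (G powr q) powr (1 / q)" using G assms by (simp add: powr_powr)
  also have "\<dots> < (2 powr (- real (d * s)) * S) powr (1 / q)"
    using S assms unfolding inv by (intro powr_less_mono2) (auto simp: field_simps)
  also have "\<dots> = mean_discrepancy s q D"
    by (simp add: mean_discrepancy_def S_def assms(1))
  finally have mean: "G < mean_discrepancy s q D" .
  \<comment> \<open>An average exceeding \<open>G powr q\<close> forces some term to exceed
    it.\<close>
  have "\<exists>T\<in>dyadic_vectors s. G < Lq_discrepancy q (dyadic_shift D T)"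
  proof (rule ccontr)
    assume "\<not> ?thesis"
    then have le: "Lq_discrepancy q (dyadic_shift D T) \<le> G" if "T \<in> dyadic_vectors s" for T
      using that by (auto simp: not_less)
    have "S \<le> (\<Sum>T\<in>(dyadic_vectors s :: (real ^ 'n) set). G powr q)"
      unfolding S_def using le assms by (intro sum_mono powr_mono2) (auto simp: Lq_discrepancy_def)
    also have "\<dots> = 2 ^ (d * s) * G powr q"
      by (simp add: card_dyadic_vectors assms(1))
    finally show False using S by simp
  qed
  with mean show ?thesis by (auto simp: G_def L_def)
qed

end
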